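(* Almost surely, for all $t\in[0,1)$ the set $\mathcal{G}(t)$ contains no infinite connected component.
   Context: $\mathcal{B}$ is the infinite 3-regular tree (Bethe lattice), identified with its set of sites (vertices); for a site $i$, $\partial\{i\}$ denotes the set of its three neighbours. Connectedness of sets of sites is in the graph $\mathcal{B}$. Let $I=[1/2,1]\cup\{\infty\}$. The function $\Phi: I\times I\times[0,1]\to I$ is defined by $\Phi(x,y,z)=x$ if $x\ge z$; $\Phi(x,y,z)=y$ if $x<z\le y$; and $\Phi(x,y,z)=\infty$ otherwise. $F$ is the distribution function of an $I$-valued random variable given by $F(t)=0$ for $t\le 1/2$, $F(t)=\ln(2t)$ for $1/2<t\le 1$, $F(t)=\ln 2$ for $1<t<\infty$, $F(\infty)=1$ (atom of mass $1-\ln 2$ at $\infty$). The family $((U_i,Y_{i\to j}):i\in\mathcal{B},j\in\partial\{i\})$ has a joint law that is invariant under automorphisms of $\mathcal{B}$, with the $U_i$ i.i.d. uniform on $[0,1]$ and the $Y_{i\to j}$ being $I$-valued, such that for all $i\in\mathcal{B}$, $j\in\partial\{i\}$: (1) $Y_{j\to i}$ has distribution function $F$; (2) $Y_{j\to i}=\Phi(\min(Y_{i\to k},Y_{i\to l}),\max(Y_{i\to k},Y_{i\to l}),U_i)$ a.s., where $\{k,l\}=\partial\{i\}\setminus\{j\}$; and (3) for each finite connected $S\subset\mathcal{B}$, the variables $(Y_{i\to j}:i\in S,j\notin S,j\in\partial\{i\})$ are independent of each other and of $(U_i:i\in S)$. (Such a law exists.) For $i\in\mathcal{B}$ define $Z_i=\min\{Y_{j\to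 i}:j\in\partial\{i\}\}=\min\{Y_{i\to j}:j\in\partial\{i\},\,Y_{i\to j}\ge U_i\}$ (the two expressions agree a.s. by (2)), with $Z_i=\infty$ if the last set is empty. For $t\in[0,1]$ define $\mathcal{G}(t)=\{i\in\mathcal{B}:U_i\le t,\ Z_i>t\}$ (the green, i.e. active but not frozen, sites at time $t$). *)

theory Defs
  imports "HOL-Probability.Probability"
begin

definition nbrs :: "('v \<Rightarrow> 'v \<Rightarrow> bool) \<Rightarrow> 'v \<Rightarrow> 'v set" where
  "nbrs E i = {j. E i j}"

definition connected_set :: "('v \<Rightarrow> 'v \<Rightarrow> bool) \<Rightarrow> 'v set \<Rightarrow> bool" where
  "connected_set E S \<longleftrightarrow>
     (\<forall>x\<in>S. \<forall>y\<in>S. (\<lambda>a b. E a b \<and> a \<in> S \<and> b \<in> S)\<^sup>*\<^sup>* x y)"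

definition connected_comp :: "('v \<Rightarrow> 'v \<Rightarrow> bool) \<Rightarrow> 'v set \<Rightarrow> 'v set \<Rightarrow> bool" where
  "connected_comp E S C \<longleftrightarrow>
     C \<noteq> {} \<and> C \<subseteq> S \<and> connected_set E C \<and>
     (\<forall>D. C \<subseteq> D \<and> D \<subseteq> S \<and> connected_set E D \<longrightarrow> D = C)"

definition is_cycle :: "('v \<Rightarrow> 'v \<Rightarrow> bool) \<Rightarrow> 'v list \<Rightarrow> bool" where
  "is_cycle E p \<longleftrightarrow>
     3 \<le> length p \<and> distinct p \<and> successively E p \<and> E (last p) (hd p)"

text \<open>
  The sites are all elements of the type. No infiniteness condition is needed:
  a finite tree has a vertex of degree at most one.\<close>

definition bethe_lattice :: "('v \<Rightarrow> 'v \<Rightarrow> bool) \<Rightarrow> bool" where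
  "bethe_lattice E \<longleftrightarrow>
     symp E \<and> irreflp E \<and> connected_set E UNIV \<and> (\<nexists>p. is_cycle E p) \<and>
     (\<forall>i. card (nbrs E i) = 3)"

definition graph_automorphism :: "('v \<Rightarrow> 'v \<Rightarrow> bool) \<Rightarrow> ('v \<Rightarrow> 'v) \<Rightarrow> bool" where
  "graph_automorphism E \<phi> \<longleftrightarrow> bij \<phi> \<and> (\<forall>i j. E (\<phi> i) (\<phi> j) \<longleftrightarrow> E i j)"

definition dir_edges :: "('v \<Rightarrow> 'v \<Rightarrow> bool) \<Rightarrow> ('v \<times> 'v) set" where
  "dir_edges E = {(i, j). E i j}"

definition out_edges :: "('v \<Rightarrow> 'v \<Rightarrow> bool) \<Rightarrow> 'v set \<Rightarrow> ('v \<times> 'v) set" where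
  "out_edges E S = {(i, j). i \<in> S \<and> j \<notin> S \<and> E i j}"

definition val_set :: "ereal set" where
  "val_set = {ereal (1/2)..1} \<union> {\<infinity>}"

definition Phi :: "ereal \<Rightarrow> ereal \<Rightarrow> real \<Rightarrow> ereal" where
  "Phi x y z = (if x \<ge> ereal z then x else if x < ereal z \<and> ereal z \<le> y then y else \<infinity>)"

definition F_dist :: "ereal \<Rightarrow> real" where
  "F_dist t =
     (if t \<le> ereal (1/2) then 0
      else if t \<le> 1 then ln (2 * real_of_ereal t)
      else if t < \<infinity> then ln 2
      else 1)"

text \<open>
  \<^term>\<open>Y i j\<close> is the variable attached to the directed edge from \<open>i\<close> to \<open>j\<close>; its values at
  non-adjacent pairs are irrelevant. The independence condition asks that the boundary variables
  be mutually independent and that the \<open>\<sigma>\<close>-algebra they generate be independent of the one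
  generated by the \<^term>\<open>U i\<close> with \<open>i \<in> S\<close>.
\<close>

locale stationary_family = prob_space M
  for M :: "'a measure"
    and E :: "'v \<Rightarrow> 'v \<Rightarrow> bool"
    and U :: "'v \<Rightarrow> 'a \<Rightarrow> real"
    and Y :: "'v \<Rightarrow> 'v \<Rightarrow> 'a \<Rightarrow> ereal" +
  assumes U_indep: "indep_vars (\<lambda>_. borel) U UNIV"
    and U_uniform: "distr M borel (U i) = uniform_measure lborel {0..1}"
    and Y_measurable: "E i j \<Longrightarrow> random_variable borel (Y i j)"
    and Y_val: "E i j \<Longrightarrow> \<omega> \<in> space M \<Longrightarrow> Y i j \<omega> \<in> val_set"
    and law_invariant: "graph_automorphism E \<phi> \<Longrightarrow>
      distr M ((\<Pi>\<^sub>M i\<in>UNIV. borel) \<Otimes>\<^sub>M (\<Pi>\<^sub>M e\<in>dir_edges E. borel))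
        (\<lambda>\<omega>. (\<lambda>i. U (\<phi> i) \<omega>, \<lambda>(i, j)\<in>dir_edges E. Y (\<phi> i) (\<phi> j) \<omega>)) =
      distr M ((\<Pi>\<^sub>M i\<in>UNIV. borel) \<Otimes>\<^sub>M (\<Pi>\<^sub>M e\<in>dir_edges E. borel))
        (\<lambda>\<omega>. (\<lambda>i. U i \<omega>, \<lambda>(i, j)\<in>dir_edges E. Y i j \<omega>))"
    and Y_dist: "E i j \<Longrightarrow> prob {\<omega> \<in> space M. Y j i \<omega> \<le> t} = F_dist t"
    and Y_rec: "E i j \<Longrightarrow> {k, l} = nbrs E i - {j} \<Longrightarrow>
      AE \<omega> in M. Y j i \<omega> =
        Phi (min (Y i k \<omega>) (Y i l \<omega>)) (max (Y i k \<omega>) (Y i l \<omega>)) (U i \<omega>)"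
    and Y_boundary_indep: "finite S \<Longrightarrow> connected_set E S \<Longrightarrow>
      indep_vars (\<lambda>_. borel) (\<lambda>(i, j). Y i j) (out_edges E S)"
    and Y_U_indep: "finite S \<Longrightarrow> connected_set E S \<Longrightarrow>
      indep_set
        (sets (vimage_algebra (space M) (\<lambda>\<omega>. \<lambda>(i, j)\<in>out_edges E S. Y i j \<omega>)
                 (\<Pi>\<^sub>M e\<in>out_edges E S. borel)))
        (sets (vimage_algebra (space M) (\<lambda>\<omega>. \<lambda>i\<in>S. U i \<omega>) (\<Pi>\<^sub>M i\<in>S. borel)))"

definition Z_time ::
  "('v \<Rightarrow> 'v \<Rightarrow> bool) \<Rightarrow> ('v \<Rightarrow> 'v \<Rightarrow> 'a \<Rightarrow> ereal) \<Rightarrow> 'v \<Rightarrow> 'a \<Rightarrow> ereal" where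
  "Z_time E Y i \<omega> = Min {Y j i \<omega> | j. j \<in> nbrs E i}"

definition green ::
  "('v \<Rightarrow> 'v \<Rightarrow> bool) \<Rightarrow> ('v \<Rightarrow> 'a \<Rightarrow> real) \<Rightarrow> ('v \<Rightarrow> 'v \<Rightarrow> 'a \<Rightarrow> ereal) \<Rightarrow> real \<Rightarrow> 'a \<Rightarrow> 'v set"
where
  "green E U Y t \<omega> = {i. U i \<omega> \<le> t \<and> Z_time E Y i \<omega> > ereal t}"

text \<open>
  The second expression for the freezing time. The infimum of the empty set in \<^typ>\<open>ereal\<close> is
  \<open>\<infinity>\<close>, which is the convention wanted here.
\<close>

lemma (in stationary_family) Z_time_alt:
  assumes "bethe_lattice E"
  shows "AE \<omega> in M. Z_time E Y i \<omega> = Inf {Y i j \<omega> | j. j \<in> nbrs E i \<and> Y i j \<omega> \<ge> ereal (U i \<omega>)}"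
proof -
  from assms have "card (nbrs E i) = 3"
    by (simp add: bethe_lattice_def)
  then obtain a b c where n: "nbrs E i = {a, b, c}" and d: "a \<noteq> b" "a \<noteq> c" "b \<noteq> c"
    by (auto simp: card_3_iff)
  then have e: "E i a" "E i b" "E i c"
    by (auto simp: nbrs_def)
  have "AE \<omega> in M. Y a i \<omega> = Phi (min (Y i b \<omega>) (Y i c \<omega>)) (max (Y i b \<omega>) (Y i c \<omega>)) (U i \<omega>)"
    using n d e by (intro Y_rec) auto
  moreover have "AE \<omega> in M. Y b i \<omega> = Phi (min (Y i a \<omega>) (Y i c \<omega>)) (max (Y i a \<omega>) (Y i c \<omega>)) (U i \<omega>)"
    using n d e by (intro Y_rec) auto
  moreover have "AE \<omega> in M. Y c i \<omega> = Phi (min (Y i a \<omega>) (Y i b \<omega>)) (max (Y i a \<omega>) (Y i b \<omega>)) (U i \<omega>)"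
    using n d e by (intro Y_rec) auto
  ultimately show ?thesis
  proof eventually_elim
    case (elim \<omega>)
    let ?u = "ereal (U i \<omega>)"
    have P: "Phi (min x y) (max x y) (U i \<omega>) =
        min (if x \<ge> ?u then x else \<infinity>) (if y \<ge> ?u then y else \<infinity>)" for x y
      by (cases x y rule: linorder_le_cases) (auto simp: Phi_def min_absorb1 min_absorb2
          max_absorb1 max_absorb2 not_le dest: order.trans)
    let ?f = "\<lambda>j. if Y i j \<omega> \<ge> ?u then Y i j \<omega> else \<infinity>"
    have "Z_time E Y i \<omega> = Min {Y a i \<omega>, Y b i \<omega>, Y c i \<omega>}"
      unfolding Z_time_def n by (rule arg_cong[where f = Min]) auto
    also have "\<dots> = min (?f a) (min (?f b) (?f c))"
      unfolding elim P by (simp add: ac_simps)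
    also have "\<dots> = Inf {Y i j \<omega> | j. j \<in> nbrs E i \<and> Y i j \<omega> \<ge> ?u}"
    proof (rule antisym)
      show "min (?f a) (min (?f b) (?f c)) \<le> Inf {Y i j \<omega> | j. j \<in> nbrs E i \<and> Y i j \<omega> \<ge> ?u}"
        unfolding n by (rule Inf_greatest) (auto simp: min_le_iff_disj)
      have "Inf {Y i j \<omega> | j. j \<in> nbrs E i \<and> Y i j \<omega> \<ge> ?u} \<le> ?f j" if "j \<in> nbrs E i" for j
        using that by (auto intro!: Inf_lower)
      then show "Inf {Y i j \<omega> | j. j \<in> nbrs E i \<and> Y i j \<omega> \<ge> ?u} \<le> min (?f a) (min (?f b) (?f c))"
        unfolding n by simp
    qed
    finally show ?case .
  qed
qed

end

theory Submission
  imports Defs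
begin

text \<open>
  If two adjacent sites are green at time \<open>t\<close> and one of them is still green at a later time \<open>s\<close>,
  then so is the other. Hence an infinite green cluster \<open>C\<close> at time \<open>t\<close> is still green at some
  rational time \<open>s\<close> between \<open>max t (1/2)\<close> and \<open>1\<close>, and it suffices to treat one fixed such \<open>s\<close>.

  At a fixed time \<open>s\<close> the cluster is explored along directed edges. A site with \<open>U \<le> s\<close> stays green
  through a branch with variable \<open>Y\<close> iff \<open>Y \<notin> [U, s]\<close>, which together has probability
  \<open>s - s F(s) + \<integral>\<^sub>0\<^sup>s F(u) du = 1/2\<close>. As every site has two children, independence and
  inclusion-exclusion give \<open>p\<^sub>n\<^sub>+\<^sub>1 \<le> p\<^sub>n - s p\<^sub>n\<^sup>2\<close> for the probability \<open>p\<^sub>n\<close> that the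
  exploration reaches depth \<open>n\<close>. So \<open>p\<^sub>n\<close> tends to \<open>0\<close>: the exploration is a critical branching
  process.
\<close>

section \<open>Branches of the tree\<close>

text \<open>For a neighbour \<open>k\<close> of \<open>j\<close> this is the component of the tree
  without \<open>j\<close> that contains \<open>k\<close>. Both ends of a step avoid
  \<open>j\<close>, which makes the step relation symmetric when \<open>E\<close> is.\<close>

definition branch :: "('v \<Rightarrow> 'v \<Rightarrow> bool) \<Rightarrow> 'v \<Rightarrow> 'v \<Rightarrow> 'v set" where
  "branch E j k = {v. (\<lambda>a b. E a b \<and> a \<noteq> j \<and> b \<noteq> j)\<^sup>*\<^sup>* k v}"

text \<open>Loop erasure: when the walk returns to a vertex of the path, the path is cut there. The
  bound on \<open>set p\<close> confines the path to a branch, which \<open>successively\<close>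
  alone does not do for a one-vertex path.\<close>

lemma rtranclp_imp_distinct_path:
  assumes "r\<^sup>*\<^sup>* x y"
  shows "\<exists>p. p \<noteq> [] \<and> hd p = x \<and> last p = y \<and> distinct p \<and> successively r p \<and> set p \<subseteq> {v. r\<^sup>*\<^sup>* x v}"
  using assms
proof (induction rule: rtranclp_induct)
  case base
  show ?case by (rule exI[of _ "[x]"]) auto
next
  case (step y z)
  then obtain p where p: "p \<noteq> []" "hd p = x" "last p = y" "distinct p" "successively r p"
      "set p \<subseteq> {v. r\<^sup>*\<^sup>* x v}"
    by blast
  show ?case
  proof (cases "z \<in> set p")
    case True
    then obtain p1 p2 where p12: "p = (p1 @ [z]) @ p2" by (auto simp: in_set_conv_decomp)
    then have "successively r (p1 @ [z])"
      using p(5) by (simp only: successively_append_iff)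
    moreover have "hd (p1 @ [z]) = x"
      using p(2) p12 by (cases p1) auto
    ultimately show ?thesis
      using p p12 by (intro exI[of _ "p1 @ [z]"]) auto
  next
    case False
    with p step show ?thesis
      by (intro exI[of _ "p @ [z]"]) (auto simp: successively_append_iff)
  qed
qed

lemma root_in_branch: "k \<in> branch E j k"
  by (simp add: branch_def)

lemma branch_step: "v \<in> branch E j k \<Longrightarrow> E v w \<Longrightarrow> v \<noteq> j \<Longrightarrow> w \<noteq> j \<Longrightarrow> w \<in> branch E j k"
  by (auto simp: branch_def intro: rtranclp.rtrancl_into_rtrancl)

lemma branch_induct [consumes 1, case_names root step]:
  assumes "v \<in> branch E j k"
    and "P k"
    and "\<And>a b. a \<in> branch E j k \<Longrightarrow> P a \<Longrightarrow> E a b \<Longrightarrow> a \<noteq> j \<Longrightarrow> b \<noteq> j \<Longrightarrow> P b"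
  shows "P v"
proof -
  have "(\<lambda>a b. E a b \<and> a \<noteq> j \<and> b \<noteq> j)\<^sup>*\<^sup>* k v"
    using assms(1) by (simp add: branch_def)
  then show ?thesis
  proof (induction rule: rtranclp_induct)
    case (step a b)
    then show ?case
      using assms(3)[of a b] by (simp add: branch_def)
  qed (rule assms(2))
qed

lemma branch_avoids: "v \<in> branch E j k \<Longrightarrow> k \<noteq> j \<Longrightarrow> v \<noteq> j"
  by (induction rule: branch_induct) auto

text \<open>After its last visit to \<open>k\<close> the walk avoids \<open>k\<close>, so it stays
  in the branch of the child through which it left.\<close>

lemma branch_subset_children:
  assumes "v \<in> branch E j k" "v \<noteq> k"
  shows "\<exists>l\<in>nbrs E k - {j}. v \<in> branch E k l"
proof -
  have "v = k \<or> (\<exists>l\<in>nbrs E k - {j}. v \<in> branch E k l)"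
    using assms(1)
  proof (induction rule: branch_induct)
    case (step a b)
    then show ?case
      by (cases "a = k"; cases "b = k") (auto simp: nbrs_def intro: root_in_branch branch_step)
  qed simp
  with assms(2) show ?thesis by simp
qed

text \<open>The two sets index the variables that determine \<open>Y\<^bsub>j \<rightarrow> k\<^esub>\<close> once the recursion has been
  unfolded \<open>n\<close> times: the sites met on the way, and the directed edges through which the
  unexplored part enters.\<close>

primrec explored_sites :: "('v \<Rightarrow> 'v \<Rightarrow> bool) \<Rightarrow> nat \<Rightarrow> 'v \<Rightarrow> 'v \<Rightarrow> 'v set" where
  "explored_sites E 0 j k = {}"
| "explored_sites E (Suc n) j k = insert k (\<Union>l\<in>nbrs E k - {j}. explored_sites E n k l)"

primrec frontier_edges :: "('v \<Rightarrow> 'v \<Rightarrow> bool) \<Rightarrow> nat \<Rightarrow> 'v \<Rightarrow> 'v \<Rightarrow> ('v \<times> 'v) set" where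
  "frontier_edges E 0 j k = {(j, k)}"
| "frontier_edges E (Suc n) j k = (\<Union>l\<in>nbrs E k - {j}. frontier_edges E n k l)"

text \<open>The disjoint sum places site and edge variables in one index set, so that a single
  independence statement covers both.\<close>

definition exploration :: "('v \<Rightarrow> 'v \<Rightarrow> bool) \<Rightarrow> nat \<Rightarrow> 'v \<Rightarrow> 'v \<Rightarrow> ('v + 'v \<times> 'v) set" where
  "exploration E n j k = Inl ` explored_sites E n j k \<union> Inr ` frontier_edges E n j k"

section \<open>Separation properties of the 3-regular tree\<close>

locale bethe =
  fixes E :: "'v \<Rightarrow> 'v \<Rightarrow> bool"
  assumes bethe: "bethe_lattice E"
begin

lemma E_sym: "E i j \<Longrightarrow> E j i"
  using bethe by (auto simp: bethe_lattice_def dest: sympD)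

lemma E_irrefl: "\<not> E i i"
  using bethe by (auto simp: bethe_lattice_def irreflp_def)

lemma E_connected: "E\<^sup>*\<^sup>* x y"
  using bethe by (simp add: bethe_lattice_def connected_set_def)

lemma card_nbrs: "card (nbrs E i) = 3"
  using bethe by (simp add: bethe_lattice_def)

lemma finite_nbrs: "finite (nbrs E i)"
  using card_nbrs[of i] by (intro card_ge_0_finite) simp

lemma children:
  assumes "E j k"
  obtains l m where "nbrs E k - {j} = {l, m}" "l \<noteq> m"
proof -
  have "card (nbrs E k - {j}) = 2"
    using assms E_sym[of j k] card_nbrs[of k] finite_nbrs[of k] by (simp add: nbrs_def)
  then show thesis
    using that by (auto simp: card_2_iff)
qed

text \<open>Spheres around a site are finite and exhaust the connected graph. Countability lets the
  null sets attached to single edges be merged into one.\<close>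

lemma countable_sites: "countable (UNIV :: 'v set)"
proof -
  fix r :: 'v
  have fin: "finite {v. (E ^^ n) r v}" for n
  proof (induction n)
    case (Suc n)
    have "{v. (E ^^ Suc n) r v} = (\<Union>w\<in>{v. (E ^^ n) r v}. nbrs E w)"
      by (auto simp: nbrs_def)
    with Suc finite_nbrs show ?case by simp
  qed auto
  have "UNIV = (\<Union>n. {v. (E ^^ n) r v})"
    using E_connected[of r] by (auto simp: rtranclp_power)
  also have "countable \<dots>"
    using fin by (intro countable_UN) (auto intro: countable_finite)
  finally show ?thesis .
qed

lemma countable_site_pairs: "countable (UNIV :: ('v \<times> 'v) set)"
  using countable_SIGMA[OF countable_sites countable_sites] by simp

text \<open>A simple path from \<open>k\<close> to \<open>l\<close> inside the branch avoids
  \<open>j\<close>; closing it through \<open>j\<close> would give a cycle.\<close>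

lemma neighbours_separated:
  assumes "E j k" "E j l" "k \<noteq> l"
  shows "l \<notin> branch E j k"
proof
  let ?r = "\<lambda>a b. E a b \<and> a \<noteq> j \<and> b \<noteq> j"
  assume "l \<in> branch E j k"
  then have "?r\<^sup>*\<^sup>* k l" by (simp add: branch_def)
  from rtranclp_imp_distinct_path[OF this] obtain p
    where p: "p \<noteq> []" "hd p = k" "last p = l" "distinct p" "successively ?r p"
      "set p \<subseteq> branch E j k"
    by (auto simp: branch_def)
  have "k \<noteq> j" using assms E_irrefl by auto
  then have "j \<notin> set p" using p(6) branch_avoids[of j E j k] by blast
  moreover have "successively E p"
    using p(5) by (rule successively_mono) auto
  moreover have "2 \<le> length p"
    using p assms(3) by (cases p; cases "tl p") auto
  ultimately have "is_cycle E (j # p)"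
    using p assms E_sym[of j l] by (auto simp: is_cycle_def successively_Cons)
  with bethe show False by (auto simp: bethe_lattice_def)
qed

lemma branch_unique:
  assumes "E j k" "E j l" "v \<in> branch E j k" "v \<in> branch E j l"
  shows "k = l"
proof (rule ccontr)
  assume "k \<noteq> l"
  let ?r = "\<lambda>a b. E a b \<and> a \<noteq> j \<and> b \<noteq> j"
  have "symp ?r"
    using E_sym by (auto intro!: sympI)
  then have "symp ?r\<^sup>*\<^sup>*" by (rule symp_rtranclp)
  moreover have "?r\<^sup>*\<^sup>* k v" "?r\<^sup>*\<^sup>* l v"
    using assms(3,4) by (simp_all add: branch_def)
  ultimately have "?r\<^sup>*\<^sup>* k l"
    by (blast dest: sympD intro: rtranclp_trans)
  then have "l \<in> branch E j k" by (simp add: branch_def)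
  with neighbours_separated[OF assms(1,2) \<open>k \<noteq> l\<close>] show False by simp
qed

text \<open>Seen from \<open>k\<close>, the site \<open>j\<close> is a neighbour other than
  \<open>l\<close>, hence outside the branch of \<open>l\<close>. A walk in that branch therefore
  never meets \<open>j\<close>.\<close>

lemma child_branch_subset:
  assumes "E j k" "l \<in> nbrs E k - {j}"
  shows "branch E k l \<subseteq> branch E j k"
proof
  fix v assume "v \<in> branch E k l"
  then show "v \<in> branch E j k"
  proof (induction rule: branch_induct)
    case root
    have "k \<noteq> j" using assms(1) E_irrefl by auto
    with assms(2) show ?case
      by (intro branch_step[OF root_in_branch[of k E j]]) (auto simp: nbrs_def)
  next
    case (step a b)
    have "j \<notin> branch E k l"
      using neighbours_separated[of k l j] assms E_sym by (auto simp: nbrs_def)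
    moreover have "b \<in> branch E k l"
      using step branch_step[of a E k l b] by simp
    ultimately show ?case
      using step branch_step[of a E j k b] by metis
  qed
qed

lemma explored_sites_subset_branch: "E j k \<Longrightarrow> explored_sites E n j k \<subseteq> branch E j k"
proof (induction n arbitrary: j k)
  case (Suc n)
  have "explored_sites E n k l \<subseteq> branch E j k" if "l \<in> nbrs E k - {j}" for l
  proof -
    have "E k l" using that by (simp add: nbrs_def)
    from Suc.IH[OF this] child_branch_subset[OF Suc.prems that] show ?thesis by (rule subset_trans)
  qed
  then show ?case
    using root_in_branch[of k E j] by (simp add: SUP_le_iff)
qed simp

text \<open>Heads of frontier edges are unexplored because the branches of different children are
  disjoint. The tail can be \<open>j\<close> itself only at depth 0, whence the
  \<open>insert\<close>.\<close>

lemma frontier_edges_in_branch: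
  assumes "E j k" "(a, b) \<in> frontier_edges E n j k"
  shows "E a b \<and> a \<in> insert j (explored_sites E n j k) \<and> b \<in> branch E j k \<and> b \<notin> explored_sites E n j k"
  using assms
proof (induction n arbitrary: j k)
  case 0
  then show ?case by (auto intro: root_in_branch)
next
  case (Suc n)
  then obtain l where l: "l \<in> nbrs E k - {j}" "(a, b) \<in> frontier_edges E n k l" by auto
  then have "E k l" by (simp add: nbrs_def)
  note IH = Suc.IH[OF this l(2)]
  have "b \<noteq> k"
    using IH \<open>E k l\<close> branch_avoids[of b E k l] E_irrefl by auto
  moreover have "b \<notin> explored_sites E n k m" if "m \<in> nbrs E k - {j}" for m
  proof
    assume b: "b \<in> explored_sites E n k m"
    have "E k m" using that by (simp add: nbrs_def)
    then have "m = l"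
      using explored_sites_subset_branch[of k m n] b IH branch_unique[of k m l b] \<open>E k l\<close> by auto
    with b IH show False by simp
  qed
  ultimately show ?case
    using IH child_branch_subset[OF Suc.prems(1) l(1)] l(1) by auto
qed

lemma finite_explored_sites: "finite (explored_sites E n j k)"
  by (induction n arbitrary: j k) (auto simp: finite_nbrs)

lemma explored_sites_reachable:
  assumes "E j k" "v \<in> explored_sites E n j k" "insert j (explored_sites E n j k) \<subseteq> S"
  shows "(\<lambda>a b. E a b \<and> a \<in> S \<and> b \<in> S)\<^sup>*\<^sup>* j v"
  using assms
proof (induction n arbitrary: j k)
  case (Suc n)
  have jk: "(\<lambda>a b. E a b \<and> a \<in> S \<and> b \<in> S)\<^sup>*\<^sup>* j k"
    using Suc.prems by (intro r_into_rtranclp) auto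
  show ?case
  proof (cases "v = k")
    case False
    then obtain l where l: "l \<in> nbrs E k - {j}" "v \<in> explored_sites E n k l"
      using Suc.prems by auto
    then have "(\<lambda>a b. E a b \<and> a \<in> S \<and> b \<in> S)\<^sup>*\<^sup>* k v"
      using Suc.prems by (intro Suc.IH[of k l]) (auto simp: nbrs_def)
    with jk show ?thesis by (rule rtranclp_trans)
  qed (use jk in simp)
qed simp

lemma connected_setI_root:
  assumes "\<And>v. v \<in> S \<Longrightarrow> (\<lambda>a b. E a b \<and> a \<in> S \<and> b \<in> S)\<^sup>*\<^sup>* r v"
  shows "connected_set E S"
proof -
  let ?r = "\<lambda>a b. E a b \<and> a \<in> S \<and> b \<in> S"
  have "symp ?r"
    using E_sym by (auto intro!: sympI)
  then have "symp ?r\<^sup>*\<^sup>*" by (rule symp_rtranclp)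
  with assms have "?r\<^sup>*\<^sup>* v w" if "v \<in> S" "w \<in> S" for v w
    using that by (blast dest: sympD intro: rtranclp_trans)
  then show ?thesis by (simp add: connected_set_def)
qed

text \<open>A walk inside \<open>C\<close> from \<open>j\<close> to \<open>v\<close> leaves
  \<open>j\<close> for the last time through some neighbour in \<open>C\<close>; \<open>v\<close>
  lies in the branch of that neighbour, which must be \<open>k\<close> by
  \<open>branch_unique\<close>.\<close>

lemma connected_set_meets_branch:
  assumes "connected_set E C" "j \<in> C" "E j k" "v \<in> C" "v \<in> branch E j k"
  shows "k \<in> C"
proof -
  have "(\<lambda>a b. E a b \<and> a \<in> C \<and> b \<in> C)\<^sup>*\<^sup>* j v"
    using assms by (simp add: connected_set_def)
  then have "v = j \<or> (\<exists>k'\<in>C. E j k' \<and> v \<in> branch E j k')"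
  proof (induction rule: rtranclp_induct)
    case (step a b)
    then show ?case
      by (cases "a = j"; cases "b = j") (auto intro: root_in_branch branch_step)
  qed simp
  moreover have "v \<noteq> j"
    using branch_avoids[OF assms(5)] assms(3) E_irrefl by auto
  ultimately show ?thesis
    using branch_unique assms by blast
qed

lemma infinite_branch_at_site:
  assumes "infinite C"
  shows "\<exists>k\<in>nbrs E i. infinite (C \<inter> branch E i k)"
proof (rule ccontr)
  assume *: "\<not> ?thesis"
  have "v = i \<or> (\<exists>k\<in>nbrs E i. v \<in> branch E i k)" for v
    using E_connected[of i v]
  proof (induction rule: rtranclp_induct)
    case (step a b)
    then show ?case
      by (cases "a = i"; cases "b = i") (auto simp: nbrs_def intro: root_in_branch branch_step)
  qed simp
  then have "C \<subseteq> insert i (\<Union>k\<in>nbrs E i. C \<inter> branch E i k)" by auto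
  moreover have "finite \<dots>"
    unfolding finite_insert using * finite_nbrs by (intro finite_UN_I) auto
  ultimately show False using assms finite_subset by blast
qed

text \<open>The step of Konig's lemma: a branch is its root together with finitely many child
  branches, so one of them inherits an infinite part of \<open>C\<close>.\<close>

lemma infinite_branch_at_child:
  assumes "infinite (C \<inter> branch E j k)"
  shows "\<exists>l\<in>nbrs E k - {j}. infinite (C \<inter> branch E k l)"
proof (rule ccontr)
  assume *: "\<not> ?thesis"
  have "C \<inter> branch E j k \<subseteq> insert k (\<Union>l\<in>nbrs E k - {j}. C \<inter> branch E k l)"
    using branch_subset_children[of _ E j k] by blast
  moreover have "finite \<dots>"
    unfolding finite_insert using * finite_nbrs by (intro finite_UN_I) auto
  ultimately show False using assms finite_subset by blast
qed

end

section \<open>Independence of the explored branches\<close>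

text \<open>Measurability refers to the product over \<open>K\<close>, whose points are extensional
  on \<open>K\<close>, while \<open>f\<close> is to be applied to full configurations. Invariance
  under \<open>restrict\<close> connects the two.\<close>

definition depends_on ::
  "'i set \<Rightarrow> 'b measure \<Rightarrow> (('i \<Rightarrow> ereal) \<Rightarrow> 'b) \<Rightarrow> bool" where
  "depends_on K N f \<longleftrightarrow>
     f \<in> measurable (\<Pi>\<^sub>M i\<in>K. borel) N \<and> (\<forall>x. f (restrict x K) = f x)"

lemma depends_on_mono:
  assumes "depends_on K N f" "K \<subseteq> L"
  shows "depends_on L N f"
proof -
  have "(\<lambda>x. f (restrict x K)) \<in> measurable (\<Pi>\<^sub>M i\<in>L. borel) N"
    using assms by (intro measurable_compose[OF measurable_restrict_subset]) (auto simp: depends_on_def)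
  moreover have "f (restrict x L) = f x" for x
  proof -
    have "restrict (restrict x L) K = restrict x K"
      using assms(2) by (auto simp: restrict_def fun_eq_iff)
    then show ?thesis
      using assms(1) unfolding depends_on_def by metis
  qed
  ultimately show ?thesis
    using assms(1) by (simp add: depends_on_def)
qed

lemma depends_on_component: "i \<in> K \<Longrightarrow> depends_on K borel (\<lambda>x. x i)"
  by (auto simp: depends_on_def)

lemma depends_on_measurable: "depends_on K N f \<Longrightarrow> f \<in> measurable (\<Pi>\<^sub>M i\<in>K. borel) N"
  by (simp add: depends_on_def)

lemma depends_on_restrict: "depends_on K N f \<Longrightarrow> f (restrict x K) = f x"
  by (simp add: depends_on_def)

text \<open>A configuration \<open>x\<close> lists the site variables under \<^const>\<open>Inl\<close> and the edge variables under
  \<^const>\<open>Inr\<close>. The recursion is unfolded \<open>n\<close> times; by \<open>unfolded_Y_eq\<close> below the result is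
  almost surely \<open>Y\<^bsub>j \<rightarrow> k\<^esub>\<close> again, but as an explicit function of finitely many independent
  variables.\<close>

primrec unfolded_Y ::
  "('v \<Rightarrow> 'v \<Rightarrow> bool) \<Rightarrow> nat \<Rightarrow> 'v \<Rightarrow> 'v \<Rightarrow> ('v + 'v \<times> 'v \<Rightarrow> ereal) \<Rightarrow> ereal" where
  "unfolded_Y E 0 j k x = x (Inr (j, k))"
| "unfolded_Y E (Suc n) j k x =
     Min ((\<lambda>l. if x (Inl k) \<le> unfolded_Y E n k l x then unfolded_Y E n k l x else \<infinity>) ` (nbrs E k - {j}))"

text \<open>The sites of the path are tested from the side of \<open>j\<close> only: the edges leading back towards \<open>j\<close>
  are not examined, so that the event is a function of the variables in the branch.\<close>

primrec green_path ::
  "('v \<Rightarrow> 'v \<Rightarrow> bool) \<Rightarrow> ereal \<Rightarrow> nat \<Rightarrow> 'v \<Rightarrow> 'v \<Rightarrow> ('v + 'v \<times> 'v \<Rightarrow> ereal) \<Rightarrow> bool" where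
  "green_path E s 0 j k x \<longleftrightarrow> s < x (Inr (j, k))"
| "green_path E s (Suc n) j k x \<longleftrightarrow>
     x (Inl k) \<le> s \<and>
     (\<forall>l\<in>nbrs E k - {j}. \<not> (x (Inl k) \<le> unfolded_Y E n k l x \<and> unfolded_Y E n k l x \<le> s)) \<and>
     (\<exists>l\<in>nbrs E k - {j}. green_path E s n k l x)"

text \<open>A value below \<open>u\<close> is discarded by being set to \<infinity>, which exceeds
  \<open>s\<close> because \<open>s\<close> is finite. This turns the recursion for \<open>Y\<close>
  into the condition that no child value lies in the interval from \<open>u\<close> to
  \<open>s\<close>.\<close>

lemma less_Min_filtered_iff:
  fixes f :: "'l \<Rightarrow> ereal"
  assumes "finite N" "N \<noteq> {}" "s < \<infinity>"
  shows "s < Min ((\<lambda>l. if u \<le> f l then f l else \<infinity>) ` N) \<longleftrightarrow> (\<forall>l\<in>N. \<not> (u \<le> f l \<and> f l \<le> s))"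
proof -
  have "s < Min ((\<lambda>l. if u \<le> f l then f l else \<infinity>) ` N) \<longleftrightarrow> (\<forall>l\<in>N. s < (if u \<le> f l then f l else \<infinity>))"
    using assms(1,2) by (subst Min_gr_iff) blast+
  then show ?thesis using assms(3) by (auto simp: not_le)
qed

section \<open>Locality of the unfolded recursion and of the path event\<close>

context bethe
begin

lemma depends_on_unfolded_Y: "depends_on (exploration E n j k) borel (unfolded_Y E n j k)"
proof (induction n arbitrary: j k)
  case 0
  show ?case
    unfolding unfolded_Y.simps by (rule depends_on_component) (simp add: exploration_def)
next
  case (Suc n)
  let ?K = "exploration E (Suc n) j k"
  have k: "Inl k \<in> ?K" by (simp add: exploration_def)
  have dep: "depends_on ?K borel (unfolded_Y E n k l)" if "l \<in> nbrs E k - {j}" for l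
    using that by (intro depends_on_mono[OF Suc.IH]) (auto simp: exploration_def)
  have [measurable]: "(\<lambda>x. x (Inl k) :: ereal) \<in> borel_measurable (\<Pi>\<^sub>M i\<in>?K. borel)"
    using depends_on_measurable[OF depends_on_component[OF k]] .
  have "unfolded_Y E (Suc n) j k \<in> borel_measurable (\<Pi>\<^sub>M i\<in>?K. borel)"
    unfolding unfolded_Y.simps
  proof (rule borel_measurable_Min)
    fix l assume "l \<in> nbrs E k - {j}"
    note [measurable] = depends_on_measurable[OF dep[OF this]]
    show "(\<lambda>x. if x (Inl k) \<le> unfolded_Y E n k l x then unfolded_Y E n k l x else \<infinity>)
        \<in> borel_measurable (\<Pi>\<^sub>M i\<in>?K. borel)"
      by measurable
  qed (simp add: finite_nbrs)
  moreover have "unfolded_Y E (Suc n) j k (restrict x ?K) = unfolded_Y E (Suc n) j k x" for x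
    unfolding unfolded_Y.simps
    using depends_on_restrict[OF dep, of _ x] k by (intro arg_cong[of _ _ Min] image_cong) auto
  ultimately show ?case
    by (simp only: depends_on_def simp_thms)
qed

lemma depends_on_green_path:
  "depends_on (exploration E n j k) (count_space UNIV) (green_path E s n j k)"
proof (induction n arbitrary: j k)
  case 0
  have "Inr (j, k) \<in> exploration E 0 j k" by (simp add: exploration_def)
  from depends_on_component[OF this] show ?case
    unfolding green_path.simps depends_on_def by auto
next
  case (Suc n)
  let ?K = "exploration E (Suc n) j k"
  let ?N = "nbrs E k - {j}"
  have k: "Inl k \<in> ?K" by (simp add: exploration_def)
  have sub: "exploration E n k l \<subseteq> ?K" if "l \<in> ?N" for l
    using that by (auto simp: exploration_def)
  note Y = depends_on_mono[OF depends_on_unfolded_Y sub]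
  note G = depends_on_mono[OF Suc.IH sub]
  note [simp] = finite_nbrs
  have [measurable]: "(\<lambda>x. x (Inl k) :: ereal) \<in> borel_measurable (\<Pi>\<^sub>M i\<in>?K. borel)"
    using depends_on_measurable[OF depends_on_component[OF k]] .
  have [measurable]: "Measurable.pred (\<Pi>\<^sub>M i\<in>?K. borel)
      (\<lambda>x. \<forall>l\<in>?N. \<not> (x (Inl k) \<le> unfolded_Y E n k l x \<and> unfolded_Y E n k l x \<le> s))"
  proof (rule pred_intros_finite(3))
    fix l assume "l \<in> ?N"
    from depends_on_measurable[OF Y[OF this]]
    have [measurable]: "unfolded_Y E n k l \<in> borel_measurable (\<Pi>\<^sub>M i\<in>?K. borel)" .
    show "Measurable.pred (\<Pi>\<^sub>M i\<in>?K. borel)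
        (\<lambda>x. \<not> (x (Inl k) \<le> unfolded_Y E n k l x \<and> unfolded_Y E n k l x \<le> s))"
      by (intro pred_intros_logic; unfold pred_def; measurable)
  qed simp
  have [measurable]: "Measurable.pred (\<Pi>\<^sub>M i\<in>?K. borel) (\<lambda>x. \<exists>l\<in>?N. green_path E s n k l x)"
    by (rule pred_intros_finite(4)) (auto intro: depends_on_measurable[OF G])
  have "Measurable.pred (\<Pi>\<^sub>M i\<in>?K. borel) (green_path E s (Suc n) j k)"
    unfolding green_path.simps by measurable
  moreover have "green_path E s (Suc n) j k (restrict x ?K) = green_path E s (Suc n) j k x" for x
  proof -
    have "restrict x ?K (Inl k) = x (Inl k)" using k by simp
    then show ?thesis
      unfolding green_path.simps
      by (intro conj_cong ball_cong bex_cong refl)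
        (simp_all only: depends_on_restrict[OF Y] depends_on_restrict[OF G])
  qed
  ultimately show ?case
    by (simp only: depends_on_def simp_thms)
qed

lemma children_nonempty: "E j k \<Longrightarrow> nbrs E k - {j} \<noteq> {}"
  by (elim children) auto

text \<open>A path entering a branch makes the interval condition for that branch automatic. This
  simplifies the events in the inclusion-exclusion of \<open>prob_green_path_Suc_le\<close>.\<close>

lemma green_path_imp_unfolded_Y_greater:
  "E j k \<Longrightarrow> s < \<infinity> \<Longrightarrow> green_path E s n j k x \<Longrightarrow> s < unfolded_Y E n j k x"
  using less_Min_filtered_iff[OF _ children_nonempty] finite_nbrs by (cases n) auto

text \<open>Boundary independence is available for connected sets only. Adding \<open>j\<close>
  joins the two explored regions into one such set, whose sites and outgoing edges carry both
  explorations.\<close>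

definition explored_ball :: "nat \<Rightarrow> 'v \<Rightarrow> 'v \<Rightarrow> 'v \<Rightarrow> 'v set" where
  "explored_ball n j k l = insert j (explored_sites E n j k \<union> explored_sites E n j l)"

lemma explored_ball_connected:
  assumes "E j k" "E j l"
  shows "finite (explored_ball n j k l)" "connected_set E (explored_ball n j k l)"
proof -
  let ?S = "explored_ball n j k l"
  show "finite ?S"
    by (simp add: explored_ball_def finite_explored_sites)
  show "connected_set E ?S"
  proof (rule connected_setI_root)
    fix v assume "v \<in> ?S"
    then consider "v = j" | "v \<in> explored_sites E n j k" | "v \<in> explored_sites E n j l"
      by (auto simp: explored_ball_def)
    then show "(\<lambda>a b. E a b \<and> a \<in> ?S \<and> b \<in> ?S)\<^sup>*\<^sup>* j v"
    proof cases
      case 2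
      with assms(1) show ?thesis
        by (rule explored_sites_reachable) (auto simp: explored_ball_def)
    next
      case 3
      with assms(2) show ?thesis
        by (rule explored_sites_reachable) (auto simp: explored_ball_def)
    qed simp
  qed
qed

lemma explored_ball_commute: "explored_ball n j k l = explored_ball n j l k"
  by (auto simp: explored_ball_def)

lemma exploration_subset_ball:
  assumes "E j k" "E j l" "k \<noteq> l"
  shows "exploration E n j k \<subseteq>
    Inl ` explored_ball n j k l \<union> Inr ` out_edges E (explored_ball n j k l)"
proof -
  have "(a, b) \<in> out_edges E (explored_ball n j k l)" if "(a, b) \<in> frontier_edges E n j k" for a b
  proof -
    note f = frontier_edges_in_branch[OF assms(1) that]
    have "k \<noteq> j" using assms(1) E_irrefl by auto
    then have "b \<noteq> j" using f branch_avoids[of b E j k] by auto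
    moreover have "b \<notin> explored_sites E n j l"
      using f explored_sites_subset_branch[OF assms(2)] branch_unique[OF assms(1,2)] assms(3) by blast
    ultimately show ?thesis
      using f by (auto simp: out_edges_def explored_ball_def)
  qed
  then show ?thesis
    by (auto simp: exploration_def explored_ball_def)
qed

text \<open>Distinct branches at \<open>j\<close> share no site. The index \<open>Inl j\<close> is
  put on the side of \<open>l\<close>, so that events of that side may also involve the variable at
  \<open>j\<close>.\<close>

lemma explorations_disjoint:
  assumes "E j k" "E j l" "k \<noteq> l"
  shows "exploration E n j k \<inter> insert (Inl j) (exploration E n j l) = {}"
proof -
  have "k \<noteq> j" using assms(1) E_irrefl by auto
  then have "j \<notin> explored_sites E n j k"
    using explored_sites_subset_branch[OF assms(1)] branch_avoids[of j E j k] by blast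
  moreover have "explored_sites E n j k \<inter> explored_sites E n j l = {}"
    using explored_sites_subset_branch assms branch_unique[OF assms(1,2)] by blast
  moreover have "frontier_edges E n j k \<inter> frontier_edges E n j l = {}"
    using frontier_edges_in_branch[OF assms(1)] frontier_edges_in_branch[OF assms(2)]
      branch_unique[OF assms(1,2)] assms(3) by fast
  ultimately show ?thesis
    by (auto simp: exploration_def)
qed

end

section \<open>The joint family of site and edge variables\<close>

locale bethe_family = stationary_family M E U Y + bethe E
  for M :: "'a measure"
    and E :: "'v \<Rightarrow> 'v \<Rightarrow> bool"
    and U :: "'v \<Rightarrow> 'a \<Rightarrow> real"
    and Y :: "'v \<Rightarrow> 'v \<Rightarrow> 'a \<Rightarrow> ereal"
begin

lemma U_measurable [measurable]: "U i \<in> borel_measurable M"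
  using U_indep by (simp add: indep_vars_def)

text \<open>Site values are embedded into \<open>ereal\<close> so that all variables form one family
  with a common value type.\<close>

definition var :: "'v + 'v \<times> 'v \<Rightarrow> 'a \<Rightarrow> ereal" where
  "var i \<omega> = (case i of Inl v \<Rightarrow> ereal (U v \<omega>) | Inr e \<Rightarrow> Y (fst e) (snd e) \<omega>)"

lemma var_simps [simp]: "var (Inl v) \<omega> = ereal (U v \<omega>)" "var (Inr (a, b)) \<omega> = Y a b \<omega>"
  by (simp_all add: var_def)

text \<open>Three assumptions combine: \<open>Y_U_indep\<close> separates the edge block from the
  site block, then \<open>Y_boundary_indep\<close> and \<open>U_indep\<close> factorise within each
  block.\<close>

lemma indep_vars_var:
  assumes S: "finite S" "connected_set E S"
  shows "indep_vars (\<lambda>_. borel) var (Inl ` S \<union> Inr ` out_edges E S)"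
  unfolding indep_vars_def2
proof (intro conjI ballI)
  let ?O = "out_edges E S"
  show meas: "var i \<in> borel_measurable M" if "i \<in> Inl ` S \<union> Inr ` ?O" for i
    using that by (auto simp: var_def[abs_def] out_edges_def intro: Y_measurable)
  let ?MU = "vimage_algebra (space M) (\<lambda>\<omega>. \<lambda>i\<in>S. U i \<omega>) (\<Pi>\<^sub>M i\<in>S. borel)"
  let ?MY = "vimage_algebra (space M) (\<lambda>\<omega>. \<lambda>(i, j)\<in>?O. Y i j \<omega>) (\<Pi>\<^sub>M e\<in>?O. borel)"
  have MU: "U v \<in> borel_measurable ?MU" if "v \<in> S" for v
  proof -
    have "(\<lambda>\<omega>. \<lambda>i\<in>S. U i \<omega>) \<in> measurable ?MU (\<Pi>\<^sub>M i\<in>S. borel)"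
      by (rule measurable_vimage_algebra1) (auto simp: space_PiM)
    from measurable_compose[OF this measurable_component_singleton[OF that]] that
    show ?thesis by simp
  qed
  have MY: "(\<lambda>\<omega>. Y (fst e) (snd e) \<omega>) \<in> borel_measurable ?MY" if "e \<in> ?O" for e
  proof -
    have "(\<lambda>\<omega>. \<lambda>(i, j)\<in>?O. Y i j \<omega>) \<in> measurable ?MY (\<Pi>\<^sub>M e\<in>?O. borel)"
      by (rule measurable_vimage_algebra1) (auto simp: space_PiM)
    from measurable_compose[OF this measurable_component_singleton[OF that]] that
    show ?thesis by (simp add: case_prod_beta)
  qed
  show "indep_sets (\<lambda>i. {var i -` A \<inter> space M |A. A \<in> sets borel}) (Inl ` S \<union> Inr ` ?O)"
  proof (rule indep_setsI)
    show "{var i -` A \<inter> space M |A. A \<in> sets borel} \<subseteq> events" if "i \<in> Inl ` S \<union> Inr ` ?O" for i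
      using meas[OF that] by (auto intro: measurable_sets)
    fix A J
    assume J: "J \<noteq> {}" "J \<subseteq> Inl ` S \<union> Inr ` ?O" "finite J"
      and "\<forall>j\<in>J. A j \<in> {var j -` B \<inter> space M |B. B \<in> sets borel}"
    then have "\<forall>j\<in>J. \<exists>B. B \<in> sets borel \<and> A j = var j -` B \<inter> space M" by auto
    then obtain B where B: "\<And>j. j \<in> J \<Longrightarrow> B j \<in> sets borel"
        and AB: "\<And>j. j \<in> J \<Longrightarrow> A j = var j -` B j \<inter> space M"
      by metis
    define J1 where "J1 = Inl -` J"
    define J2 where "J2 = Inr -` J"
    have JJ: "J = Inl ` J1 \<union> Inr ` J2"
      unfolding J1_def J2_def using J(2) by auto
    have fin: "finite J1" "finite J2" and sub: "J1 \<subseteq> S" "J2 \<subseteq> ?O"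
      using J(2,3) by (auto simp: J1_def J2_def intro: finite_vimageI)
    \<comment> \<open>Intersecting with \<open>space M\<close> gives the sure event for an empty
      index set, where the bare intersection would be the whole type.\<close>
    define A1 where "A1 = space M \<inter> (\<Inter>v\<in>J1. A (Inl v))"
    define A2 where "A2 = space M \<inter> (\<Inter>e\<in>J2. A (Inr e))"
    have Inl: "A (Inl v) = U v -` (ereal -` B (Inl v)) \<inter> space M"
      and BInl: "ereal -` B (Inl v) \<in> sets borel" if "v \<in> J1" for v
      using that AB[of "Inl v"] B[of "Inl v"] measurable_sets_borel[of ereal borel "B (Inl v)"]
      by (auto simp: J1_def)
    have Inr: "A (Inr e) = (\<lambda>\<omega>. Y (fst e) (snd e) \<omega>) -` B (Inr e) \<inter> space M"
      and BInr: "B (Inr e) \<in> sets borel" if "e \<in> J2" for e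
      using that AB[of "Inr e"] B[of "Inr e"] by (auto simp: J2_def var_def)
    have "A1 \<in> sets ?MU"
    proof (cases "J1 = {}")
      case True
      then show ?thesis using sets.top[of ?MU] by (simp add: A1_def)
    next
      case False
      have "A (Inl v) \<in> sets ?MU" if "v \<in> J1" for v
        using measurable_sets[OF MU BInl[OF that]] that sub by (auto simp: Inl)
      then have "(\<Inter>v\<in>J1. A (Inl v)) \<in> sets ?MU"
        using False fin by (intro sets.finite_INT) auto
      then show ?thesis
        using sets.Int[OF sets.top[of ?MU]] by (simp add: A1_def)
    qed
    moreover have "A2 \<in> sets ?MY"
    proof (cases "J2 = {}")
      case True
      then show ?thesis using sets.top[of ?MY] by (simp add: A2_def)
    next
      case False
      have "A (Inr e) \<in> sets ?MY" if "e \<in> J2" for e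
        using measurable_sets[OF MY BInr[OF that]] that sub by (auto simp: Inr)
      then have "(\<Inter>e\<in>J2. A (Inr e)) \<in> sets ?MY"
        using False fin by (intro sets.finite_INT) auto
      then show ?thesis
        using sets.Int[OF sets.top[of ?MY]] by (simp add: A2_def)
    qed
    ultimately have "prob (A2 \<inter> A1) = prob A2 * prob A1"
      by (intro indep_setD[OF Y_U_indep[OF S]])
    moreover have "prob A1 = (\<Prod>v\<in>J1. prob (A (Inl v)))"
    proof (cases "J1 = {}")
      case False
      then have "A1 = (\<Inter>v\<in>J1. A (Inl v))" by (auto simp: A1_def Inl)
      then have "prob A1 = prob (\<Inter>v\<in>J1. U v -` (ereal -` B (Inl v)) \<inter> space M)"
        by (simp add: Inl)
      also have "\<dots> = (\<Prod>v\<in>J1. prob (U v -` (ereal -` B (Inl v)) \<inter> space M))"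
        using False fin BInl by (intro indep_varsD[OF U_indep]) auto
      finally show ?thesis by (simp add: Inl)
    qed (simp add: A1_def prob_space)
    moreover have "prob A2 = (\<Prod>e\<in>J2. prob (A (Inr e)))"
    proof (cases "J2 = {}")
      case False
      then have "A2 = (\<Inter>e\<in>J2. A (Inr e))" by (auto simp: A2_def Inr)
      then have "prob A2 = prob (\<Inter>e\<in>J2. (case e of (a, b) \<Rightarrow> Y a b) -` B (Inr e) \<inter> space M)"
        by (simp add: Inr case_prod_beta)
      also have "\<dots> = (\<Prod>e\<in>J2. prob ((case e of (a, b) \<Rightarrow> Y a b) -` B (Inr e) \<inter> space M))"
        using False fin BInr sub by (intro indep_varsD[OF Y_boundary_indep[OF S]]) auto
      finally show ?thesis by (simp add: Inr case_prod_beta)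
    qed (simp add: A2_def prob_space)
    moreover have "(\<Inter>j\<in>J. A j) = A2 \<inter> A1"
      using J(1) AB unfolding A1_def A2_def JJ by auto
    moreover have "(\<Prod>j\<in>J. prob (A j)) = (\<Prod>v\<in>J1. prob (A (Inl v))) * (\<Prod>e\<in>J2. prob (A (Inr e)))"
      unfolding JJ using fin by (subst prod.union_disjoint) (auto simp: prod.reindex)
    ultimately show "prob (\<Inter>j\<in>J. A j) = (\<Prod>j\<in>J. prob (A j))" by simp
  qed
qed

text \<open>Restrictions of an independent family to disjoint index blocks are independent. The
  blocks are indexed by \<open>bool\<close>, and the two predicates become random variables with
  values in \<open>bool\<close>.\<close>

lemma prob_depends_on_disjoint:
  assumes S: "finite S" "connected_set E S"
    and K: "K \<subseteq> Inl ` S \<union> Inr ` out_edges E S" "L \<subseteq> Inl ` S \<union> Inr ` out_edges E S" "K \<inter> L = {}"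
    and P: "depends_on K (count_space UNIV) P" and Q: "depends_on L (count_space UNIV) Q"
  shows "\<P>(\<omega> in M. P (\<lambda>i. var i \<omega>) \<and> Q (\<lambda>i. var i \<omega>)) =
    \<P>(\<omega> in M. P (\<lambda>i. var i \<omega>)) * \<P>(\<omega> in M. Q (\<lambda>i. var i \<omega>))"
proof -
  let ?K = "case_bool K L" and ?P = "case_bool P Q"
  have "indep_vars (\<lambda>b. \<Pi>\<^sub>M i\<in>?K b. borel) (\<lambda>b \<omega>. restrict (\<lambda>i. var i \<omega>) (?K b)) UNIV"
    using K by (intro indep_vars_restrict[OF indep_vars_var[OF S]])
      (auto simp: disjoint_family_on_def split: bool.split)
  from indep_vars_compose2[OF this, of ?P "\<lambda>_. count_space UNIV"]
  have "indep_vars (\<lambda>_. count_space UNIV) (\<lambda>b \<omega>. ?P b (restrict (\<lambda>i. var i \<omega>) (?K b))) UNIV"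
    using depends_on_measurable[OF P] depends_on_measurable[OF Q] by (auto split: bool.split)
  also have "(\<lambda>b \<omega>. ?P b (restrict (\<lambda>i. var i \<omega>) (?K b))) = (\<lambda>b \<omega>. ?P b (\<lambda>i. var i \<omega>))"
    using depends_on_restrict[OF P] depends_on_restrict[OF Q] by (auto split: bool.split)
  finally have "indep_vars (\<lambda>_. count_space UNIV) (\<lambda>b \<omega>. ?P b (\<lambda>i. var i \<omega>)) UNIV" .
  from indep_varsD[OF this, of UNIV "\<lambda>_. {True}"] show ?thesis
    by (simp add: UNIV_bool vimage_def Int_def conj_ac Collect_conj_eq[symmetric] mult.commute)
qed

lemma measurable_depends_on:
  assumes "depends_on K N f" "\<And>a b. Inr (a, b) \<in> K \<Longrightarrow> E a b"
  shows "(\<lambda>\<omega>. f (\<lambda>i. var i \<omega>)) \<in> measurable M N"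
proof -
  have "var i \<in> borel_measurable M" if "i \<in> K" for i
    using that assms(2) by (cases i) (auto simp: var_def[abs_def] intro!: Y_measurable)
  then have "(\<lambda>\<omega>. restrict (\<lambda>i. var i \<omega>) K) \<in> measurable M (\<Pi>\<^sub>M i\<in>K. borel)"
    by (intro measurable_restrict) auto
  from measurable_compose[OF this depends_on_measurable[OF assms(1)]] show ?thesis
    by (simp add: depends_on_restrict[OF assms(1)])
qed

lemma measurable_unfolded_Y:
  "E j k \<Longrightarrow> (\<lambda>\<omega>. unfolded_Y E n j k (\<lambda>i. var i \<omega>)) \<in> borel_measurable M"
  by (rule measurable_depends_on[OF depends_on_unfolded_Y])
    (auto simp: exploration_def dest: frontier_edges_in_branch)

lemma measurable_green_path:
  "E j k \<Longrightarrow> Measurable.pred M (\<lambda>\<omega>. green_path E s n j k (\<lambda>i. var i \<omega>))"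
  by (rule measurable_depends_on[OF depends_on_green_path])
    (auto simp: exploration_def dest: frontier_edges_in_branch)

text \<open>The recursion is required on all edges for one outcome, so that the arguments about
  clusters can be made pointwise.\<close>

definition recursive_at :: "'a \<Rightarrow> bool" where
  "recursive_at \<omega> \<longleftrightarrow> (\<forall>j k. E j k \<longrightarrow> Y j k \<omega> =
     Min ((\<lambda>l. if ereal (U k \<omega>) \<le> Y k l \<omega> then Y k l \<omega> else \<infinity>) ` (nbrs E k - {j})))"

lemma AE_recursive: "AE \<omega> in M. recursive_at \<omega>"
proof -
  have "AE \<omega> in M. E j k \<longrightarrow> Y j k \<omega> =
      Min ((\<lambda>l. if ereal (U k \<omega>) \<le> Y k l \<omega> then Y k l \<omega> else \<infinity>) ` (nbrs E k - {j}))" for j k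
  proof (cases "E j k")
    case True
    obtain l m where lm: "nbrs E k - {j} = {l, m}" "l \<noteq> m"
      using True by (rule children)
    have "AE \<omega> in M. Y j k \<omega> =
        Phi (min (Y k l \<omega>) (Y k m \<omega>)) (max (Y k l \<omega>) (Y k m \<omega>)) (U k \<omega>)"
      using Y_rec[OF E_sym[OF True] lm(1)[symmetric]] .
    then show ?thesis
    proof eventually_elim
      case (elim \<omega>)
      \<comment> \<open>\<open>Phi\<close> selects the smallest value that is at least
        \<open>u\<close>. Replacing smaller values by \<infinity> makes this a plain minimum,
        symmetric in the two children.\<close>
      have "Phi (min x y) (max x y) u =
          min (if x \<ge> ereal u then x else \<infinity>) (if y \<ge> ereal u then y else \<infinity>)" for x y u
        by (cases x y rule: linorder_le_cases) (auto simp: Phi_def min_absorb1 min_absorb2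
            max_absorb1 max_absorb2 not_le dest: order.trans)
      then show ?case using elim lm by simp
    qed
  qed simp
  then have "AE \<omega> in M. \<forall>e\<in>UNIV. E (fst e) (snd e) \<longrightarrow> Y (fst e) (snd e) \<omega> =
      Min ((\<lambda>l. if ereal (U (snd e) \<omega>) \<le> Y (snd e) l \<omega> then Y (snd e) l \<omega> else \<infinity>) `
        (nbrs E (snd e) - {fst e}))"
    by (intro AE_ball_countable'[rotated] countable_site_pairs) auto
  then show ?thesis by (simp add: recursive_at_def)
qed

lemma unfolded_Y_eq: "recursive_at \<omega> \<Longrightarrow> E j k \<Longrightarrow> unfolded_Y E n j k (\<lambda>i. var i \<omega>) = Y j k \<omega>"
proof (induction n arbitrary: j k)
  case (Suc n)
  have "unfolded_Y E n k l (\<lambda>i. var i \<omega>) = Y k l \<omega>" if "l \<in> nbrs E k - {j}" for l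
    using that Suc by (auto simp: nbrs_def)
  then have "unfolded_Y E (Suc n) j k (\<lambda>i. var i \<omega>) =
      Min ((\<lambda>l. if ereal (U k \<omega>) \<le> Y k l \<omega> then Y k l \<omega> else \<infinity>) ` (nbrs E k - {j}))"
    unfolding unfolded_Y.simps var_simps by (intro arg_cong[of _ _ Min] image_cong) auto
  also have "\<dots> = Y j k \<omega>"
    using Suc.prems by (simp add: recursive_at_def)
  finally show ?case .
qed simp

lemma Y_greater_iff:
  assumes "recursive_at \<omega>" "E j k"
  shows "ereal s < Y j k \<omega> \<longleftrightarrow>
    (\<forall>l\<in>nbrs E k - {j}. \<not> (ereal (U k \<omega>) \<le> Y k l \<omega> \<and> Y k l \<omega> \<le> ereal s))"
proof -
  have "Y j k \<omega> = Min ((\<lambda>l. if ereal (U k \<omega>) \<le> Y k l \<omega> then Y k l \<omega> else \<infinity>) ` (nbrs E k - {j}))"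
    using assms by (simp add: recursive_at_def)
  then show ?thesis
    using less_Min_filtered_iff[of "nbrs E k - {j}" "ereal s"] finite_nbrs[of k]
      children_nonempty[OF assms(2)] by simp
qed

end

section \<open>Criticality\<close>

text \<open>The value \<open>1/2\<close>, for every \<open>s\<close>, is what makes the exploration of a green cluster a critical
  branching process.\<close>

lemma nn_integral_escape:
  fixes s :: real
  assumes s: "1/2 < s" "s < 1"
  shows "(\<integral>\<^sup>+u. ennreal (1 - ln (2 * s)) * indicator {0..1/2} u +
      ennreal (1 - ln (2 * s) + ln (2 * u)) * indicator {1/2..s} u \<partial>lborel) = ennreal (1/2)"
proof -
  let ?c = "1 - ln (2 * s)"
  have c: "0 \<le> ?c" using ln_le_minus_one[of "2 * s"] s by simp
  have "(\<integral>\<^sup>+u. ennreal ?c * indicator {0..1/2 :: real} u \<partial>lborel) = ennreal ?c * ennreal (1/2)"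
    by (subst nn_integral_cmult_indicator) auto
  also have "\<dots> = ennreal (?c / 2)"
    using c by (simp add: ennreal_mult'[symmetric] del: ennreal_half)
  finally have 1: "(\<integral>\<^sup>+u. ennreal ?c * indicator {0..1/2 :: real} u \<partial>lborel) = ennreal (?c / 2)" .
  \<comment> \<open>An antiderivative of \<open>?c + ln (2 * u)\<close>. It vanishes at
    \<open>s\<close> because \<open>?c * s = s - s * ln (2 * s)\<close>, so only its value at 1/2
    contributes.\<close>
  let ?F = "\<lambda>u. ?c * u + (u * ln (2 * u) - u)"
  have 2: "(\<integral>\<^sup>+u. ennreal (?c + ln (2 * u)) * indicator {1/2..s} u \<partial>lborel) = ennreal (?F s - ?F (1/2))"
  proof (rule nn_integral_FTC_Icc)
    fix u :: real assume u: "u \<in> {1/2..s}"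
    show "DERIV ?F u :> ?c + ln (2 * u)"
      using u by (auto intro!: derivative_eq_intros simp: field_simps)
    show "0 \<le> ?c + ln (2 * u)" using u c by auto
  qed (use s in auto)
  have F: "?F s - ?F (1/2) = 1/2 - ?c / 2" by (simp add: field_simps)
  have "?c \<le> 1" using s by simp
  with 1 2 c show ?thesis
    unfolding F by (subst nn_integral_add) (auto simp: ennreal_plus[symmetric] simp del: ennreal_plus ennreal_half)
qed

text \<open>The sequence decreases and stays nonnegative, and its limit is a fixed point of
  \<open>x - s * x^2\<close>, hence 0. The start \<open>1 / (2 * s)\<close> is where this map is
  largest; below it the map is increasing, so upper bounds on probabilities can be iterated.\<close>

lemma quadratic_recursion_tendsto_0:
  fixes p :: "nat \<Rightarrow> real"
  assumes s: "0 < s" and p0: "p 0 = 1 / (2 * s)" and rec: "\<And>n. p (Suc n) = p n - s * (p n)\<^sup>2"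
  shows "0 \<le> p n \<and> p n \<le> 1 / (2 * s)" and "p \<longlonglongrightarrow> 0"
proof -
  have bounds: "0 \<le> p n \<and> p n \<le> 1 / (2 * s)" for n
  proof (induction n)
    case (Suc n)
    then have "s * p n \<le> 1" using s by (simp add: field_simps)
    then have "0 \<le> p n * (1 - s * p n)" using Suc by simp
    moreover have "p (Suc n) = p n * (1 - s * p n)"
      by (simp add: rec power2_eq_square algebra_simps)
    moreover have "p (Suc n) \<le> p n" using s by (simp add: rec)
    ultimately show ?case using Suc by linarith
  qed (use s p0 in simp)
  then show "0 \<le> p n \<and> p n \<le> 1 / (2 * s)" .
  have "decseq p" using s by (intro decseq_SucI) (simp add: rec)
  then obtain L where L: "p \<longlonglongrightarrow> L"
    using decseq_convergent[of p 0] bounds by blast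
  have "(\<lambda>n. p n - s * (p n)\<^sup>2) \<longlonglongrightarrow> L - s * L\<^sup>2"
    by (intro tendsto_intros L)
  moreover have "(\<lambda>n. p n - s * (p n)\<^sup>2) \<longlonglongrightarrow> L"
    using LIMSEQ_Suc[OF L] by (simp add: rec)
  ultimately have "L - s * L\<^sup>2 = L" by (rule LIMSEQ_unique)
  with s L show "p \<longlonglongrightarrow> 0" by simp
qed

section \<open>Survival probability of the exploration\<close>

context bethe_family
begin

lemma prob_Y_le:
  assumes "E j k"
  shows "\<P>(\<omega> in M. Y j k \<omega> \<le> t) = F_dist t"
  using Y_dist[OF E_sym[OF assms]] .

lemma prob_Y_greater:
  assumes "E j k" "1/2 < s" "s < 1"
  shows "\<P>(\<omega> in M. ereal s < Y j k \<omega>) = 1 - ln (2 * s)"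
proof -
  note [measurable] = Y_measurable[OF assms(1)]
  have "\<P>(\<omega> in M. ereal s < Y j k \<omega>) = 1 - \<P>(\<omega> in M. Y j k \<omega> \<le> ereal s)"
    by (subst prob_neg[symmetric]) (auto simp: not_le)
  then show ?thesis
    using assms(2,3) by (simp add: prob_Y_le[OF assms(1)] F_dist_def)
qed

lemma prob_U_le:
  assumes "0 \<le> s" "s \<le> 1"
  shows "\<P>(\<omega> in M. U i \<omega> \<le> s) = s"
proof -
  have "\<P>(\<omega> in M. U i \<omega> \<le> s) = measure (distr M borel (U i)) {..s}"
    by (subst measure_distr) (auto intro!: arg_cong[where f = prob])
  also have "\<dots> = measure lborel ({0..1} \<inter> {..s})"
    by (simp add: U_uniform measure_uniform_measure)
  also have "{0..1} \<inter> {..s} = {0..s}"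
    using assms by auto
  finally show ?thesis using assms by simp
qed

lemma connected_set_singleton: "connected_set E {j}"
  by (simp add: connected_set_def)

text \<open>The one-point set \<open>{j}\<close> is connected and has \<open>(j, l)\<close> among
  its outgoing edges.\<close>

lemma indep_var_U_Y:
  assumes "E j l"
  shows "indep_var borel (\<lambda>\<omega>. ereal (U j \<omega>)) borel (Y j l)"
proof -
  have "j \<noteq> l" using assms E_irrefl by auto
  have ind: "indep_vars (\<lambda>_. borel) var (Inl ` {j} \<union> Inr ` out_edges E {j})"
    by (rule indep_vars_var[OF _ connected_set_singleton]) simp
  have "indep_vars (\<lambda>b. \<Pi>\<^sub>M i\<in>case_bool {Inl j} {Inr (j, l)} b. borel)
      (\<lambda>b \<omega>. restrict (\<lambda>i. var i \<omega>) (case_bool {Inl j} {Inr (j, l)} b)) UNIV"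
    using assms \<open>j \<noteq> l\<close> by (intro indep_vars_restrict[OF ind])
      (auto simp: disjoint_family_on_def out_edges_def split: bool.split)
  then have "indep_vars (\<lambda>_. borel) (\<lambda>b \<omega>. case_bool (\<lambda>x. x (Inl j)) (\<lambda>x. x (Inr (j, l))) b
      (restrict (\<lambda>i. var i \<omega>) (case_bool {Inl j} {Inr (j, l)} b))) UNIV"
    by (rule indep_vars_compose2) (auto split: bool.split intro: measurable_component_singleton)
  also have "(\<lambda>b \<omega>. case_bool (\<lambda>x. x (Inl j)) (\<lambda>x. x (Inr (j, l))) b
      (restrict (\<lambda>i. var i \<omega>) (case_bool {Inl j} {Inr (j, l)} b))) =
      case_bool (\<lambda>\<omega>. ereal (U j \<omega>)) (Y j l)"
    by (auto simp: fun_eq_iff split: bool.split)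
  also have "(\<lambda>_. borel) = case_bool borel borel"
    by (auto simp: fun_eq_iff split: bool.split)
  finally show ?thesis
    unfolding indep_var_def .
qed

text \<open>Given that \<open>U j\<close> equals some \<open>u\<close> at most \<open>s\<close>,
  escape means \<open>Y j l < u\<close> or \<open>Y j l > s\<close>. By independence the probability
  is an integral over \<open>u\<close>, and \<open>nn_integral_escape\<close> evaluates its
  bound.\<close>

lemma prob_escape_le:
  assumes "E j l" and s: "1/2 < s" "s < 1"
  shows "\<P>(\<omega> in M. U j \<omega> \<le> s \<and> \<not> (ereal (U j \<omega>) \<le> Y j l \<omega> \<and> Y j l \<omega> \<le> ereal s)) \<le> 1/2"
proof -
  note [measurable] = Y_measurable[OF assms(1)]
  let ?c = "1 - ln (2 * s)"
  let ?X = "{(u, y). u \<le> ereal s \<and> \<not> (u \<le> y \<and> y \<le> ereal s)}"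
  let ?D = "distr M borel (Y j l)"
  have c: "0 \<le> ?c" using ln_le_minus_one[of "2 * s"] s by simp
  have X [measurable]: "?X \<in> sets (borel \<Otimes>\<^sub>M borel)"
  proof -
    have "{p \<in> space (borel \<Otimes>\<^sub>M borel). fst p \<le> ereal s \<and> \<not> (fst p \<le> snd p \<and> snd p \<le> ereal s)}
        \<in> sets (borel \<Otimes>\<^sub>M borel)"
      by measurable
    also have "{p \<in> space (borel \<Otimes>\<^sub>M borel). fst p \<le> ereal s \<and>
        \<not> (fst p \<le> snd p \<and> snd p \<le> ereal s)} = ?X"
      by (auto simp: space_pair_measure)
    finally show ?thesis .
  qed
  interpret DY: prob_space ?D
    by (rule prob_space_distr) measurable
  have X': "?X \<in> sets (N \<Otimes>\<^sub>M ?D)" if "sets N = sets borel" for N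
    using X sets_pair_measure_cong[OF that, of ?D borel] by simp
  have sec: "(\<lambda>v. emeasure ?D (Pair v -` ?X)) \<in> borel_measurable borel"
    by (rule DY.measurable_emeasure_Pair) (rule X'[OF refl])
  have "emeasure M {\<omega> \<in> space M. U j \<omega> \<le> s \<and> \<not> (ereal (U j \<omega>) \<le> Y j l \<omega> \<and> Y j l \<omega> \<le> ereal s)}
      = emeasure (distr M (borel \<Otimes>\<^sub>M borel) (\<lambda>\<omega>. (ereal (U j \<omega>), Y j l \<omega>))) ?X"
    using X by (subst emeasure_distr) (auto intro!: arg_cong[where f = "emeasure M"])
  also have "\<dots> = emeasure (distr M borel (\<lambda>\<omega>. ereal (U j \<omega>)) \<Otimes>\<^sub>M ?D) ?X"
    using indep_var_U_Y[OF assms(1)] by (simp add: indep_var_distribution_eq)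
  also have "\<dots> = (\<integral>\<^sup>+v. emeasure ?D (Pair v -` ?X) \<partial>distr M borel (\<lambda>\<omega>. ereal (U j \<omega>)))"
    by (rule DY.emeasure_pair_measure_alt) (rule X', simp)
  also have "\<dots> = (\<integral>\<^sup>+u. emeasure ?D (Pair (ereal u) -` ?X) \<partial>distr M borel (U j))"
    using sec by (simp add: nn_integral_distr)
  also have "\<dots> = (\<integral>\<^sup>+u. emeasure ?D (Pair (ereal u) -` ?X) * indicator {0..1} u \<partial>lborel)"
    unfolding U_uniform using measurable_compose[OF _ sec, of ereal borel]
    by (subst nn_integral_uniform_measure) (auto simp: divide_ennreal_def)
  \<comment> \<open>The event \<open>Y j l < u\<close> is enlarged to \<open>Y j l \<le> u\<close>,
    of probability \<open>F_dist u\<close>. The integral is split at 1/2, up to which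
    \<open>F_dist\<close> is 0; for \<open>u > s\<close> the section is empty.\<close>
  also have "\<dots> \<le> (\<integral>\<^sup>+u. ennreal ?c * indicator {0..1/2} u +
      ennreal (?c + ln (2 * u)) * indicator {1/2..s} u \<partial>lborel)"
  proof (rule nn_integral_mono)
    fix u :: real
    have *: "emeasure ?D (Pair (ereal u) -` ?X) \<le> ennreal (?c + F_dist (ereal u))" if "u \<le> s"
    proof -
      have "emeasure ?D (Pair (ereal u) -` ?X) =
          emeasure M {\<omega> \<in> space M. Y j l \<omega> < ereal u \<or> ereal s < Y j l \<omega>}"
        using that sets_Pair1[OF X, of "ereal u"]
        by (subst emeasure_distr) (auto intro!: arg_cong[where f = "emeasure M"] simp: not_le)
      also have "\<dots> \<le> emeasure M ({\<omega> \<in> space M. ereal s < Y j l \<omega>} \<union> {\<omega> \<in> space M. Y j l \<omega> \<le> ereal u})"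
        by (rule emeasure_mono) auto
      also have "\<dots> \<le> emeasure M {\<omega> \<in> space M. ereal s < Y j l \<omega>} + emeasure M {\<omega> \<in> space M. Y j l \<omega> \<le> ereal u}"
        by (rule emeasure_subadditive) measurable
      also have "\<dots> = ennreal (?c + F_dist (ereal u))"
        using c measure_nonneg[of M "{\<omega> \<in> space M. Y j l \<omega> \<le> ereal u}"]
        by (simp add: emeasure_eq_measure prob_Y_greater[OF assms] prob_Y_le[OF assms(1)] ennreal_plus)
      finally show ?thesis .
    qed
    have zero: "emeasure ?D (Pair (ereal u) -` ?X) = 0" if "\<not> u \<le> s"
      using that by simp
    have F0: "F_dist (ereal u) = 0" if "u \<le> 1/2"
      using that by (simp add: F_dist_def)
    have F1: "F_dist (ereal u) = ln (2 * u)" if "1/2 < u" "u \<le> s"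
      using that s by (simp add: F_dist_def)
    show "emeasure ?D (Pair (ereal u) -` ?X) * indicator {0..1} u \<le>
        ennreal ?c * indicator {0..1/2} u + ennreal (?c + ln (2 * u)) * indicator {1/2..s} u"
      (is "?lhs \<le> ?r1 + ?r2")
    proof (cases "u \<le> 1/2")
      case True
      with s * F0 have "?lhs \<le> ?r1" by (auto split: split_indicator)
      then show ?thesis by (rule order_trans) simp
    next
      case False
      with s * zero F1 show ?thesis by (cases "u \<le> s") (auto split: split_indicator)
    qed
  qed
  also have "\<dots> = ennreal (1/2)"
    using s by (rule nn_integral_escape)
  finally show ?thesis
    by (simp add: emeasure_eq_measure del: ennreal_half)
qed

text \<open>The path continues through one child while the other child escapes, or through both.
  With \<open>pk\<close> and \<open>pl\<close> for the two children, inclusion-exclusion bounds the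
  probability by \<open>pk / 2 + pl / 2 - s * pk * pl\<close>, which is largest at
  \<open>pk = pl = a\<close>.\<close>

lemma prob_green_path_Suc_le:
  assumes "E i j" and s: "1/2 < s" "s < 1" and a: "0 \<le> a" "a \<le> 1 / (2 * s)"
    and IH: "\<And>k. E j k \<Longrightarrow> \<P>(\<omega> in M. green_path E (ereal s) n j k (\<lambda>i. var i \<omega>)) \<le> a"
  shows "\<P>(\<omega> in M. green_path E (ereal s) (Suc n) i j (\<lambda>i. var i \<omega>)) \<le> a - s * a\<^sup>2"
proof -
  obtain k l where kl: "nbrs E j - {i} = {k, l}" "k \<noteq> l"
    using assms(1) by (rule children)
  then have Ek: "E j k" and El: "E j l" by (auto simp: nbrs_def)
  let ?v = "\<lambda>\<omega> i. var i \<omega>"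
  let ?G = "\<lambda>k x. green_path E (ereal s) n j k x"
  let ?esc = "\<lambda>k x. x (Inl j) \<le> ereal s \<and>
      \<not> (x (Inl j) \<le> unfolded_Y E n j k x \<and> unfolded_Y E n j k x \<le> ereal s)"
  let ?low = "\<lambda>x :: 'v + 'v \<times> 'v \<Rightarrow> ereal. x (Inl j) \<le> ereal s"
  have dep_low: "depends_on {Inl j} (count_space UNIV) ?low"
    using depends_on_component[of "Inl j" "{Inl j}"] by (auto simp: depends_on_def)
  have dep_esc: "depends_on (insert (Inl j) (exploration E n j m)) (count_space UNIV) (?esc m)" for m
  proof -
    let ?K = "insert (Inl j) (exploration E n j m)"
    have 1: "depends_on ?K borel (\<lambda>x. x (Inl j))" by (rule depends_on_component) simp
    have 2: "depends_on ?K borel (unfolded_Y E n j m)"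
      by (rule depends_on_mono[OF depends_on_unfolded_Y]) auto
    note [measurable] = depends_on_measurable[OF 1] depends_on_measurable[OF 2]
    have "Measurable.pred (\<Pi>\<^sub>M i\<in>?K. borel) (?esc m)"
      by (intro pred_intros_logic; unfold pred_def; measurable)
    then show ?thesis
      using depends_on_restrict[OF 2] unfolding depends_on_def by auto
  qed
  have dep_G_low: "depends_on (insert (Inl j) (exploration E n j m)) (count_space UNIV)
      (\<lambda>x. ?low x \<and> ?G m x)" for m
  proof -
    have 1: "depends_on (insert (Inl j) (exploration E n j m)) (count_space UNIV) ?low"
      by (rule depends_on_mono[OF dep_low]) auto
    have 2: "depends_on (insert (Inl j) (exploration E n j m)) (count_space UNIV) (?G m)"
      by (rule depends_on_mono[OF depends_on_green_path]) auto
    show ?thesis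
      using 1 2 by (auto simp: depends_on_def intro!: pred_intros_logic)
  qed
  \<comment> \<open>The set \<open>L\<close> is kept general because \<open>Q\<close> is later also
    an event of the site variable at \<open>j\<close> alone.\<close>
  have prod: "\<P>(\<omega> in M. ?G m (?v \<omega>) \<and> Q (?v \<omega>)) = \<P>(\<omega> in M. ?G m (?v \<omega>)) * \<P>(\<omega> in M. Q (?v \<omega>))"
    if "E j m" "E j m'" "m \<noteq> m'" "depends_on L (count_space UNIV) Q"
      "L \<subseteq> insert (Inl j) (exploration E n j m')" for m m' Q L
  proof (rule prob_depends_on_disjoint[OF explored_ball_connected[OF that(1,2)] _ _ _ depends_on_green_path that(4)])
    show "exploration E n j m \<subseteq>
        Inl ` explored_ball n j m m' \<union> Inr ` out_edges E (explored_ball n j m m')"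
      using that by (intro exploration_subset_ball)
    show "L \<subseteq> Inl ` explored_ball n j m m' \<union> Inr ` out_edges E (explored_ball n j m m')"
    proof -
      have "exploration E n j m' \<subseteq>
          Inl ` explored_ball n j m m' \<union> Inr ` out_edges E (explored_ball n j m m')"
        using exploration_subset_ball[OF that(2,1) that(3)[symmetric], of n]
        by (simp only: explored_ball_commute[of n j m' m])
      moreover have "Inl j \<in> Inl ` explored_ball n j m m'"
        by (simp add: explored_ball_def)
      ultimately have "insert (Inl j) (exploration E n j m') \<subseteq>
          Inl ` explored_ball n j m m' \<union> Inr ` out_edges E (explored_ball n j m m')"
        by (intro insert_subsetI UnI1)
      with that(5) show ?thesis by (rule subset_trans)
    qed
    show "exploration E n j m \<inter> L = {}"
      using explorations_disjoint[OF that(1-3), of n] that(5) by auto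
  qed
  have prob_esc: "\<P>(\<omega> in M. ?esc m (?v \<omega>)) \<le> 1/2" if "E j m" for m
  proof -
    note [measurable] = measurable_unfolded_Y[OF that] Y_measurable[OF that]
    have "\<P>(\<omega> in M. ?esc m (?v \<omega>)) =
        \<P>(\<omega> in M. U j \<omega> \<le> s \<and> \<not> (ereal (U j \<omega>) \<le> Y j m \<omega> \<and> Y j m \<omega> \<le> ereal s))"
      using AE_recursive by (intro prob_eq_AE) (auto simp: unfolded_Y_eq that)
    with prob_escape_le[OF that s] show ?thesis by simp
  qed
  define pk where "pk = \<P>(\<omega> in M. ?G k (?v \<omega>))"
  define pl where "pl = \<P>(\<omega> in M. ?G l (?v \<omega>))"
  have pk: "0 \<le> pk" "pk \<le> a" and pl: "0 \<le> pl" "pl \<le> a"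
    using IH[OF Ek] IH[OF El] by (auto simp: pk_def pl_def)
  let ?A = "{\<omega> \<in> space M. ?G k (?v \<omega>) \<and> ?esc l (?v \<omega>)}"
  let ?B = "{\<omega> \<in> space M. ?G l (?v \<omega>) \<and> ?esc k (?v \<omega>)}"
  note [measurable] = measurable_unfolded_Y[OF Ek] measurable_unfolded_Y[OF El]
    measurable_green_path[OF Ek] measurable_green_path[OF El]
  have gt: "ereal s < unfolded_Y E n j m x" if "E j m" "?G m x" for m x
    using green_path_imp_unfolded_Y_greater[OF that(1) _ that(2)] by simp
  \<comment> \<open>By \<open>gt\<close>, the child that carries the path satisfies its own interval
    condition, so only that of the other child remains in \<open>?A\<close> and
    \<open>?B\<close>.\<close>
  have "\<P>(\<omega> in M. green_path E (ereal s) (Suc n) i j (?v \<omega>)) = prob (?A \<union> ?B)"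
    using gt[OF Ek] gt[OF El] unfolding green_path.simps kl
    by (intro arg_cong[where f = prob]) (auto simp: not_le)
  also have "\<dots> = prob ?A + prob ?B - prob (?A \<inter> ?B)"
    by (rule measure_Un3) (auto simp: fmeasurable_eq_sets)
  finally have incl_excl: "\<P>(\<omega> in M. green_path E (ereal s) (Suc n) i j (?v \<omega>)) =
      prob ?A + prob ?B - prob (?A \<inter> ?B)" .
  have A: "prob ?A \<le> pk * (1/2)"
    unfolding pk_def prod[OF Ek El kl(2) dep_esc subset_refl]
    by (intro mult_left_mono prob_esc El) simp
  have B: "prob ?B \<le> pl * (1/2)"
    unfolding pl_def prod[OF El Ek kl(2)[symmetric] dep_esc subset_refl]
    by (intro mult_left_mono prob_esc Ek) simp
  have AB: "prob (?A \<inter> ?B) = pk * (s * pl)"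
  proof -
    \<comment> \<open>With paths through both children both interval conditions are automatic; what
      remains of them is that the value at \<open>j\<close> is at most \<open>s\<close>.\<close>
    have "?A \<inter> ?B = {\<omega> \<in> space M. ?G k (?v \<omega>) \<and> (?low (?v \<omega>) \<and> ?G l (?v \<omega>))}"
      using gt[OF Ek] gt[OF El] by (auto simp: not_le)
    then have "prob (?A \<inter> ?B) = pk * \<P>(\<omega> in M. ?low (?v \<omega>) \<and> ?G l (?v \<omega>))"
      unfolding pk_def using prod[OF Ek El kl(2) dep_G_low subset_refl] by simp
    also have "\<P>(\<omega> in M. ?low (?v \<omega>) \<and> ?G l (?v \<omega>)) = \<P>(\<omega> in M. ?G l (?v \<omega>) \<and> ?low (?v \<omega>))"
      by (simp only: conj_commute)
    also have "\<dots> = pl * \<P>(\<omega> in M. ?low (?v \<omega>))"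
      unfolding pl_def by (rule prod[OF El Ek kl(2)[symmetric] dep_low]) simp
    also have "\<P>(\<omega> in M. ?low (?v \<omega>)) = s"
      using prob_U_le[of s j] s by simp
    finally show ?thesis by simp
  qed
  have "pk * (1/2) + pl * (1/2) - pk * (s * pl) \<le> a - s * a\<^sup>2"
  proof -
    have "s * a \<le> 1/2" using a s by (simp add: field_simps)
    moreover have "s * pk \<le> s * a" using pk s by simp
    \<comment> \<open>The two summands are the gains from raising \<open>pl\<close> to
      \<open>a\<close> with \<open>pk\<close> fixed and then \<open>pk\<close> to \<open>a\<close>;
      both are nonnegative since \<open>pk\<close> and \<open>a\<close> are at most
      \<open>1 / (2 * s)\<close>.\<close>
    ultimately have "0 \<le> (a - pk) * (1/2 - s * a) + (a - pl) * (1/2 - s * pk)"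
      using pk pl by (intro add_nonneg_nonneg mult_nonneg_nonneg) auto
    then show ?thesis by (simp add: field_simps power2_eq_square)
  qed
  with incl_excl A B AB show ?thesis by linarith
qed

text \<open>Surviving to every depth has probability at most each \<open>p n\<close>, hence 0. The
  null sets of the countably many edges are then united.\<close>

lemma AE_green_path_finite:
  assumes s: "1/2 < s" "s < 1"
  shows "AE \<omega> in M. \<forall>j k. E j k \<longrightarrow> (\<exists>n. \<not> green_path E (ereal s) n j k (\<lambda>i. var i \<omega>))"
proof -
  define p where "p = rec_nat (1 / (2 * s)) (\<lambda>_ x. x - s * x\<^sup>2)"
  have p0: "p 0 = 1 / (2 * s)" and pSuc: "\<And>n. p (Suc n) = p n - s * (p n)\<^sup>2"
    by (simp_all add: p_def)
  have "0 < s" using s by simp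
  note p = quadratic_recursion_tendsto_0[OF this p0 pSuc]
  have bound: "\<P>(\<omega> in M. green_path E (ereal s) n j k (\<lambda>i. var i \<omega>)) \<le> p n" if "E j k" for n j k
    using that
  proof (induction n arbitrary: j k)
    case 0
    \<comment> \<open>The left side is the survival probability at depth 0. The inequality is
      \<open>ln x \<le> x - 1\<close> at \<open>x = 1 / (2 * s)\<close>.\<close>
    have "1 - ln (2 * s) \<le> 1 / (2 * s)"
      using ln_le_minus_one[of "1 / (2 * s)"] s by (simp add: ln_div)
    then show ?case
      using prob_Y_greater[OF 0 s] by (simp add: p0)
  next
    case (Suc n)
    show ?case
      unfolding pSuc using p(1) Suc by (intro prob_green_path_Suc_le s) auto
  qed
  have "AE \<omega> in M. E j k \<longrightarrow> (\<exists>n. \<not> green_path E (ereal s) n j k (\<lambda>i. var i \<omega>))" for j k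
  proof (cases "E j k")
    case True
    note [measurable] = measurable_green_path[OF True]
    have "\<P>(\<omega> in M. \<forall>n. green_path E (ereal s) n j k (\<lambda>i. var i \<omega>)) \<le> p n" for n
      using bound[OF True, of n]
      by (rule order_trans[rotated]) (intro finite_measure_mono; force)
    then have "\<P>(\<omega> in M. \<forall>n. green_path E (ereal s) n j k (\<lambda>i. var i \<omega>)) \<le> 0"
      using p(2) by (intro LIMSEQ_le_const) auto
    then have "\<P>(\<omega> in M. \<forall>n. green_path E (ereal s) n j k (\<lambda>i. var i \<omega>)) = 0"
      using measure_nonneg by (intro antisym) auto
    then show ?thesis
      by (subst (asm) prob_Collect_eq_0) auto
  qed simp
  then have "AE \<omega> in M. \<forall>e\<in>UNIV. E (fst e) (snd e) \<longrightarrow>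
      (\<exists>n. \<not> green_path E (ereal s) n (fst e) (snd e) (\<lambda>i. var i \<omega>))"
    by (intro AE_ball_countable'[rotated] countable_site_pairs) auto
  then show ?thesis by simp
qed

end

section \<open>Green clusters\<close>

context bethe_family
begin

text \<open>Since \<open>F_dist\<close> is 0 at 1/2, all freezing times exceed 1/2. A cluster that
  is green at an early time can thus be followed to a level above 1/2, where the estimates
  apply.\<close>

lemma AE_Y_gt_half: "AE \<omega> in M. \<forall>j k. E j k \<longrightarrow> ereal (1/2) < Y j k \<omega>"
proof -
  have "AE \<omega> in M. E j k \<longrightarrow> ereal (1/2) < Y j k \<omega>" for j k
  proof (cases "E j k")
    case True
    note [measurable] = Y_measurable[OF True]
    have "\<P>(\<omega> in M. Y j k \<omega> \<le> ereal (1/2)) = 0"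
      by (simp only: prob_Y_le[OF True]) (simp add: F_dist_def)
    then have "AE \<omega> in M. \<not> Y j k \<omega> \<le> ereal (1/2)"
      by (subst (asm) prob_Collect_eq_0) auto
    then show ?thesis by eventually_elim (simp add: not_le)
  qed simp
  then have "AE \<omega> in M. \<forall>e\<in>UNIV. E (fst e) (snd e) \<longrightarrow> ereal (1/2) < Y (fst e) (snd e) \<omega>"
    by (intro AE_ball_countable'[rotated] countable_site_pairs) auto
  then show ?thesis by simp
qed

lemma less_Z_time_iff: "s < Z_time E Y i \<omega> \<longleftrightarrow> (\<forall>j. E j i \<longrightarrow> s < Y j i \<omega>)"
proof -
  have "{Y j i \<omega> | j. j \<in> nbrs E i} = (\<lambda>j. Y j i \<omega>) ` nbrs E i" by auto
  moreover have "nbrs E i \<noteq> {}" using card_nbrs[of i] by auto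
  ultimately have "s < Z_time E Y i \<omega> \<longleftrightarrow> (\<forall>j\<in>nbrs E i. s < Y j i \<omega>)"
    by (simp add: Z_time_def finite_nbrs)
  then show ?thesis using E_sym by (auto simp: nbrs_def)
qed

text \<open>Greenness is defined by the variables pointing into \<open>i\<close>. Each neighbour
  \<open>l\<close> is a child of \<open>i\<close> as seen from some other neighbour, so these
  variables together test every edge leaving \<open>i\<close>, which is the form used by
  \<open>green_path\<close>.\<close>

lemma green_iff:
  assumes "recursive_at \<omega>"
  shows "i \<in> green E U Y s \<omega> \<longleftrightarrow>
    U i \<omega> \<le> s \<and> (\<forall>l\<in>nbrs E i. \<not> (ereal (U i \<omega>) \<le> Y i l \<omega> \<and> Y i l \<omega> \<le> ereal s))"
proof -
  have "\<exists>j. E j i \<and> l \<noteq> j" if "l \<in> nbrs E i" for l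
  proof -
    have "E l i" using that E_sym by (simp add: nbrs_def)
    then obtain j where "j \<in> nbrs E i - {l}"
      using children_nonempty by blast
    then show ?thesis using E_sym by (auto simp: nbrs_def)
  qed
  then have "ereal s < Z_time E Y i \<omega> \<longleftrightarrow>
      (\<forall>l\<in>nbrs E i. \<not> (ereal (U i \<omega>) \<le> Y i l \<omega> \<and> Y i l \<omega> \<le> ereal s))"
    unfolding less_Z_time_iff using Y_greater_iff[OF assms, of _ i s] by blast
  then show ?thesis by (simp add: green_def)
qed

text \<open>A green cluster freezes all at once.\<close>

lemma green_later_neighbour:
  assumes rec: "recursive_at \<omega>" and "E i j"
    and "i \<in> green E U Y t \<omega>" "j \<in> green E U Y t \<omega>" "t \<le> s" "i \<in> green E U Y s \<omega>"
  shows "j \<in> green E U Y s \<omega>"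
proof -
  have "E j i" using \<open>E i j\<close> by (rule E_sym)
  have "ereal (U i \<omega>) \<le> ereal t" "ereal t < Y i j \<omega>"
    using assms by (auto simp: green_def less_Z_time_iff)
  then have "ereal (U i \<omega>) \<le> Y i j \<omega>" by (rule order_trans[OF _ less_imp_le])
  with assms(6) \<open>E i j\<close> have "ereal s < Y i j \<omega>"
    unfolding green_iff[OF rec] by (auto simp: nbrs_def not_le)
  with \<open>E i j\<close> have "\<forall>l\<in>nbrs E j - {i}. \<not> (ereal (U j \<omega>) \<le> Y j l \<omega> \<and> Y j l \<omega> \<le> ereal s)"
    using Y_greater_iff[OF rec] by blast
  moreover have "ereal s < Y j i \<omega>"
    using assms(6) \<open>E j i\<close> by (auto simp: green_def less_Z_time_iff)
  moreover have "U j \<omega> \<le> s"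
    using assms(4,5) by (simp add: green_def)
  ultimately show ?thesis
    unfolding green_iff[OF rec] by (auto simp: not_le)
qed

lemma green_later_cluster:
  assumes "recursive_at \<omega>" "connected_set E C" "C \<subseteq> green E U Y t \<omega>"
    and "t \<le> s" "i \<in> C" "i \<in> green E U Y s \<omega>"
  shows "C \<subseteq> green E U Y s \<omega>"
proof
  fix j assume "j \<in> C"
  then have "(\<lambda>a b. E a b \<and> a \<in> C \<and> b \<in> C)\<^sup>*\<^sup>* i j"
    using assms(2,5) by (simp add: connected_set_def)
  then show "j \<in> green E U Y s \<omega>"
  proof (induction rule: rtranclp_induct)
    case (step a b)
    then show ?case
      using assms green_later_neighbour[of \<omega> a b t s] by blast
  qed (rule assms(6))
qed

text \<open>At each depth some child branch contains infinitely many sites of \<open>C\<close>, and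
  connectedness places its root in \<open>C\<close>. The sites visited are therefore green, which
  gives all tests along the path, including the final bound on \<open>Y j k\<close> at depth
  0.\<close>

lemma infinite_cluster_imp_green_path:
  assumes "recursive_at \<omega>" "connected_set E C" "C \<subseteq> green E U Y s \<omega>"
    and "j \<in> C" "E j k" "infinite (C \<inter> branch E j k)"
  shows "green_path E (ereal s) n j k (\<lambda>i. var i \<omega>)"
  using assms(4-)
proof (induction n arbitrary: j k)
  case (0 j k)
  from infinite_imp_nonempty[OF 0(3)] have "k \<in> C"
    using connected_set_meets_branch[OF assms(2) 0(1,2)] by blast
  with assms(3) 0 show ?case by (auto simp: green_def less_Z_time_iff)
next
  case (Suc n j k)
  from infinite_imp_nonempty[OF Suc.prems(3)] have k: "k \<in> C"
    using connected_set_meets_branch[OF assms(2) Suc.prems(1,2)] by blast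
  obtain l where l: "l \<in> nbrs E k - {j}" "infinite (C \<inter> branch E k l)"
    using infinite_branch_at_child[OF Suc.prems(3)] by blast
  then have "green_path E (ereal s) n k l (\<lambda>i. var i \<omega>)"
    using k by (intro Suc.IH) (auto simp: nbrs_def)
  moreover have "k \<in> green E U Y s \<omega>" using k assms(3) by blast
  moreover have "unfolded_Y E n k l (\<lambda>i. var i \<omega>) = Y k l \<omega>" if "l \<in> nbrs E k" for l
    using that assms(1) by (intro unfolded_Y_eq) (auto simp: nbrs_def)
  ultimately show ?case
    using l(1) unfolding green_iff[OF assms(1)] by auto
qed

lemma AE_no_infinite_green_cluster:
  "AE \<omega> in M. \<forall>t\<in>{0..<1}. \<nexists>C. connected_comp E (green E U Y t \<omega>) C \<and> infinite C"
proof -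
  have "AE \<omega> in M. \<forall>s\<in>\<rat> \<inter> {1/2<..<1}. \<forall>j k. E j k \<longrightarrow>
      (\<exists>n. \<not> green_path E (ereal s) n j k (\<lambda>i. var i \<omega>))"
    using AE_green_path_finite by (intro AE_ball_countable'[rotated]) (auto intro: countable_Int1 countable_rat)
  with AE_recursive AE_Y_gt_half show ?thesis
  proof eventually_elim
    case (elim \<omega>)
    show ?case
    proof (intro ballI notI, elim exE conjE)
      fix t C assume t: "t \<in> {0..<1::real}" and "connected_comp E (green E U Y t \<omega>) C" and inf: "infinite C"
      then have C: "connected_set E C" "C \<subseteq> green E U Y t \<omega>"
        by (auto simp: connected_comp_def)
      obtain i where i: "i \<in> C" using infinite_imp_nonempty[OF inf] by blast
      \<comment> \<open>This is the room for a later level: site \<open>i\<close> is still green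
        just after \<open>t\<close>, and its freezing time exceeds 1/2.\<close>
      have "ereal (max t (1/2)) < min 1 (Z_time E Y i \<omega>)"
      proof -
        have "ereal t < Z_time E Y i \<omega>" "ereal (1/2) < Z_time E Y i \<omega>"
          using i C(2) elim(2) by (auto simp: green_def less_Z_time_iff)
        then show ?thesis using t by (auto simp: max_def)
      qed
      \<comment> \<open>The freezing time may be infinite, so a real \<open>r\<close> is
        interpolated first and a rational \<open>s\<close> is then chosen below it.\<close>
      then obtain r where r: "ereal (max t (1/2)) < ereal r" "ereal r < min 1 (Z_time E Y i \<omega>)"
        using ereal_dense2 by blast
      then obtain s where s: "s \<in> \<rat>" "max t (1/2) < s" "s < r"
        using Rats_dense_in_real[of "max t (1/2)" r] by auto
      then have "ereal s < ereal r" by simp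
      then have "ereal s < min 1 (Z_time E Y i \<omega>)" using r(2) by (rule less_trans)
      then have s': "s < 1" "ereal s < Z_time E Y i \<omega>" by auto
      have "i \<in> green E U Y s \<omega>"
        using i C(2) s s' by (auto simp: green_def)
      then have C': "C \<subseteq> green E U Y s \<omega>"
        using s by (intro green_later_cluster[OF elim(1) C _ i]) auto
      obtain k where "k \<in> nbrs E i" "infinite (C \<inter> branch E i k)"
        using infinite_branch_at_site[OF inf] by blast
      then have "E i k" and "green_path E (ereal s) n i k (\<lambda>i. var i \<omega>)" for n
        using infinite_cluster_imp_green_path[OF elim(1) C(1) C' i] by (auto simp: nbrs_def)
      moreover have "s \<in> \<rat> \<inter> {1/2<..<1}" using s s' by simp
      ultimately show False using elim(3) by blast
    qed
  qed
qed

end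

theorem lemma4p5:
  fixes M :: "'a measure"
    and E :: "'v \<Rightarrow> 'v \<Rightarrow> bool"
    and U :: "'v \<Rightarrow> 'a \<Rightarrow> real"
    and Y :: "'v \<Rightarrow> 'v \<Rightarrow> 'a \<Rightarrow> ereal"
  assumes "bethe_lattice E"
    and "stationary_family M E U Y"
  shows "AE \<omega> in M. \<forall>t\<in>{0..<1}. \<nexists>C. connected_comp E (green E U Y t \<omega>) C \<and> infinite C"
proof -
  interpret bethe_family M E U Y
    using assms by (intro bethe_family.intro bethe.intro)
  show ?thesis by (rule AE_no_infinite_green_cluster)
qed

end
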